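(* Let $D$ be a digraph and let $A$ and $B$ be sets of vertices and ends of $D$ such that $(A,B)$ is dispersed. If there are $n$ disjoint $A$--$B$ tracks in $D$ for every $n\in\mathbb{N}$, then there are infinitely many disjoint $A$--$B$ tracks in $D$.
   Context: Digraphs may be infinite; $V(D)$ is the vertex set of $D$; "disjoint" means vertex-disjoint; $\mathbb{N}=\{1,2,\dots\}$. A path is a digraph whose underlying undirected graph is a path and whose edges are oriented away from its startvertex; its vertices other than the startvertex and the endvertex are internal. For sets $X,Y$, a path in $D$ is an $X$--$Y$ path if it intersects $X$ precisely in its startvertex and $Y$ precisely in its endvertex; a subdigraph in place of $X$ or $Y$ stands for its vertex set, and a single vertex or end $x$ stands for $\{x\}$. An in-ray is a digraph whose underlying undirected graph is a ray and whose edges are oriented towards the unique vertex of degree 1, called its endvertex. An out-ray is a digraph whose underlying undirected graph is a ray and whose edges are oriented away from the unique vertex of degree 1, called its startvertex. All other vertices of an in-ray or out-ray are internal. An in-/out-ray means an in-ray or an out-ray. Two in-/out-rays $R_1,R_2$ of $D$ are equivalent if there are infinitely many disjoint $R_1$--$R_2$ paths and infinitely many disjoint $R_2$--$R_1$ paths in $D$. An end of $D$ is an equivalence class of in- and out-rays of $D$; $\Omega(D)$ is the set of ends of $D$. A directed double ray is a digraph whose underlying undirected graph is a double ray and whose edges are consistently oriented; all of its vertices are internal. For sets $A,B$ of vertices and ends of $D$, an $A$--$B$ track $T$ is an $A$--$B$ path, an in-ray in an end in $A$ whose endvertex is in $B$, an out-ray in an end in $B$ whose startvertex is in $A$, or a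 directed double ray whose initial segment is in an end in $A$ and whose terminal segment is in an end in $B$, such that no internal vertex of $T$ is in $A\cup B$. A track in $D-S$ is such a track of $D$ that avoids $S$. The tuple $(A,B)$ is dispersed if for every end $a\in A\cap\Omega(D)$ there is a finite set $S_a\subseteq V(D)$ such that there is no $a$--$B$ track in $D-S_a$, and for every end $b\in B\cap\Omega(D)$ there is a finite set $S_b\subseteq V(D)$ such that there is no $A$--$b$ track in $D-S_b$. *)

theory Defs
  imports "Graph_Theory.Arc_Walk" "Graph_Theory.Digraph_Component"
begin

text \<open>
  A digraph is a record satisfying \<open>wf_digraph\<close>: it may be infinite, and loops and
  parallel arcs are not excluded. Paths, rays and double rays are digraphs in their own right
  (not vertex or arc sequences); they lie in \<open>D\<close> if they satisfy \<open>subgraph _ D\<close>.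
\<close>

definition is_path :: "('a,'b) pre_digraph \<Rightarrow> 'a \<Rightarrow> 'a \<Rightarrow> bool" where
  "is_path P u v \<longleftrightarrow>
     (\<exists>p. pre_digraph.apath P u p v \<and>
          verts P = set (pre_digraph.awalk_verts P u p) \<and> arcs P = set p)"

text \<open>The vertex argument is the startvertex of the out-ray, resp. the endvertex of the in-ray.\<close>

definition out_ray :: "('a,'b) pre_digraph \<Rightarrow> 'a \<Rightarrow> bool" where
  "out_ray R v \<longleftrightarrow>
     (\<exists>(x :: nat \<Rightarrow> 'a) (e :: nat \<Rightarrow> 'b).
        inj x \<and> x 0 = v \<and> verts R = range x \<and> arcs R = range e \<and>
        (\<forall>i. tail R (e i) = x i \<and> head R (e i) = x (Suc i)))"

definition in_ray :: "('a,'b) pre_digraph \<Rightarrow> 'a \<Rightarrow> bool" where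
  "in_ray R v \<longleftrightarrow>
     (\<exists>(x :: nat \<Rightarrow> 'a) (e :: nat \<Rightarrow> 'b).
        inj x \<and> x 0 = v \<and> verts R = range x \<and> arcs R = range e \<and>
        (\<forall>i. tail R (e i) = x (Suc i) \<and> head R (e i) = x i))"

definition double_ray :: "('a,'b) pre_digraph \<Rightarrow> bool" where
  "double_ray R \<longleftrightarrow>
     (\<exists>(x :: int \<Rightarrow> 'a) (e :: int \<Rightarrow> 'b).
        inj x \<and> verts R = range x \<and> arcs R = range e \<and>
        (\<forall>i. tail R (e i) = x i \<and> head R (e i) = x (i + 1)))"

abbreviation disjoint_digraphs :: "('a,'b) pre_digraph set \<Rightarrow> bool" where
  "disjoint_digraphs \<T> \<equiv> pairwise (\<lambda>S T. disjnt (verts S) (verts T)) \<T>"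

definition set_path :: "('a,'b) pre_digraph \<Rightarrow> 'a set \<Rightarrow> 'a set \<Rightarrow> ('a,'b) pre_digraph \<Rightarrow> bool" where
  "set_path D X Y P \<longleftrightarrow> subgraph P D \<and>
     (\<exists>u v. is_path P u v \<and> verts P \<inter> X = {u} \<and> verts P \<inter> Y = {v})"

definition rays :: "('a,'b) pre_digraph \<Rightarrow> ('a,'b) pre_digraph set" where
  "rays D = {R. subgraph R D \<and> (\<exists>v. in_ray R v \<or> out_ray R v)}"

definition inf_many_paths ::
    "('a,'b) pre_digraph \<Rightarrow> ('a,'b) pre_digraph \<Rightarrow> ('a,'b) pre_digraph \<Rightarrow> bool" where
  "inf_many_paths D R\<^sub>1 R\<^sub>2 \<longleftrightarrow>
     (\<exists>\<P>. infinite \<P> \<and> disjoint_digraphs \<P> \<and> (\<forall>P\<in>\<P>. set_path D (verts R\<^sub>1) (verts R\<^sub>2) P))"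

definition ray_equiv :: "('a,'b) pre_digraph \<Rightarrow> ('a,'b) pre_digraph rel" where
  "ray_equiv D = {(R\<^sub>1, R\<^sub>2). R\<^sub>1 \<in> rays D \<and> R\<^sub>2 \<in> rays D \<and>
     inf_many_paths D R\<^sub>1 R\<^sub>2 \<and> inf_many_paths D R\<^sub>2 R\<^sub>1}"

definition ends :: "('a,'b) pre_digraph \<Rightarrow> ('a,'b) pre_digraph set set" where
  "ends D = rays D // ray_equiv D"

text \<open>
  A set of vertices and ends is a set over a sum type, vertices being tagged by \<open>Inl\<close> and ends
  by \<open>Inr\<close>.
\<close>

type_synonym ('a,'b) verts_ends = "('a + ('a,'b) pre_digraph set) set"

abbreviation vertex_part :: "('a,'b) verts_ends \<Rightarrow> 'a set" where
  "vertex_part A \<equiv> Inl -` A"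

abbreviation end_part :: "('a,'b) verts_ends \<Rightarrow> ('a,'b) pre_digraph set set" where
  "end_part A \<equiv> Inr -` A"

text \<open>
  In the first case no internal vertex can lie in \<open>A\<close> or \<open>B\<close> by definition of \<open>set_path\<close>.
  In the second and third case the vertex \<open>v\<close> is not internal, so it may lie in both \<open>A\<close> and \<open>B\<close>.
  In the last case, the in-rays contained in \<open>T\<close> are its initial segments and the out-rays
  contained in \<open>T\<close> its terminal segments. All initial segments (all terminal segments) are
  equivalent, so it does not matter which one is taken.
\<close>

definition track ::
    "('a,'b) pre_digraph \<Rightarrow> ('a,'b) verts_ends \<Rightarrow> ('a,'b) verts_ends \<Rightarrow> ('a,'b) pre_digraph \<Rightarrow> bool"
  where
  "track D A B T \<longleftrightarrow> subgraph T D \<and>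
     (set_path D (vertex_part A) (vertex_part B) T \<or>
      (\<exists>v. in_ray T v \<and> (\<exists>a\<in>end_part A. T \<in> a) \<and> v \<in> vertex_part B \<and>
           (verts T - {v}) \<inter> (vertex_part A \<union> vertex_part B) = {}) \<or>
      (\<exists>v. out_ray T v \<and> v \<in> vertex_part A \<and> (\<exists>b\<in>end_part B. T \<in> b) \<and>
           (verts T - {v}) \<inter> (vertex_part A \<union> vertex_part B) = {}) \<or>
      (double_ray T \<and>
         (\<exists>I v. subgraph I T \<and> in_ray I v \<and> (\<exists>a\<in>end_part A. I \<in> a)) \<and>
         (\<exists>J v. subgraph J T \<and> out_ray J v \<and> (\<exists>b\<in>end_part B. J \<in> b)) \<and>
         verts T \<inter> (vertex_part A \<union> vertex_part B) = {}))"

text \<open>Ends are always taken in \<open>D\<close>: a track in \<open>D - S\<close> is a track of \<open>D\<close> that avoids \<open>S\<close>.\<close>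

definition track_avoiding ::
    "('a,'b) pre_digraph \<Rightarrow> 'a set \<Rightarrow> ('a,'b) verts_ends \<Rightarrow> ('a,'b) verts_ends
      \<Rightarrow> ('a,'b) pre_digraph \<Rightarrow> bool" where
  "track_avoiding D S A B T \<longleftrightarrow> track D A B T \<and> verts T \<inter> S = {}"

definition dispersed ::
    "('a,'b) pre_digraph \<Rightarrow> ('a,'b) verts_ends \<Rightarrow> ('a,'b) verts_ends \<Rightarrow> bool" where
  "dispersed D A B \<longleftrightarrow>
     (\<forall>a\<in>end_part A. \<exists>S. finite S \<and> S \<subseteq> verts D \<and> \<not> (\<exists>T. track_avoiding D S {Inr a} B T)) \<and>
     (\<forall>b\<in>end_part B. \<exists>S. finite S \<and> S \<subseteq> verts D \<and> \<not> (\<exists>T. track_avoiding D S A {Inr b} T))"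

end

theory Submission
  imports Defs
begin

text \<open>
  The infinite family is chosen greedily, so it has to be shown that every finite family of
  disjoint tracks can be extended by a track disjoint from all its members. Call a set of vertices
  guarded if some finite set \<open>S\<close> meets every track that meets it. If the union of the
  members of a finite family is guarded by \<open>S\<close>, then among \<open>card S + 1\<close>
  disjoint tracks some track avoids \<open>S\<close> and hence all members of the family. As finite unions
  of guarded sets are guarded, it suffices that the vertex set of a single track is guarded
  (\<open>guarded_track\<close>).

  Finite sets guard themselves, so only the infinite parts of a track matter. Let \<open>R\<close> be an
  out-ray with which a track runs into an end \<open>b\<close> of \<open>B\<close>, and let \<open>S1\<close> be a finite
  set that meets every \<open>A\<close>--\<open>b\<close> track. Some tail \<open>W\<close> of \<open>R\<close> avoids \<open>S1\<close>.
  A track \<open>P\<close> that avoids \<open>S1\<close> cannot have a first vertex in \<open>W\<close>: following \<open>P\<close>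
  up to this vertex and \<open>R\<close> from there on would be an \<open>A\<close>--\<open>b\<close> track that
  avoids \<open>S1\<close>. If \<open>P\<close> meets \<open>W\<close> without having a first vertex there, then \<open>P\<close>
  starts in an end \<open>a\<close> of \<open>A\<close> and its initial segments meet \<open>R\<close> infinitely often.
  These segments are then equivalent to \<open>R\<close>, so \<open>a = b\<close>, and \<open>P\<close> is a track that
  starts in \<open>b\<close>; dispersedness, applied to \<open>b\<close> as an element of \<open>A\<close>, yields a finite
  set \<open>S2\<close> that \<open>P\<close> meets. So \<open>S1\<close>, \<open>S2\<close> and the finite part of \<open>R\<close>
  before \<open>W\<close> together guard \<open>R\<close> (\<open>guarded_out_ray\<close>). In-rays follow by reversing all
  arcs (\<open>guarded_in_ray\<close>).

  The step to \<open>a = b\<close> uses that equivalence of rays is transitive (\<open>equiv_ray_equiv\<close>).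
  This becomes visible once infinitely many disjoint paths are replaced by paths that avoid any
  given finite set (\<open>inf_many_paths_iff\<close>).
\<close>

section \<open>Large disjoint families\<close>

text \<open>
  Otherwise a choice of one vertex of \<open>S\<close> in each member would be an injection of the
  family into \<open>S\<close>.
\<close>

lemma disjoint_member_avoiding:
  fixes \<T> :: "('a,'b) pre_digraph set"
  assumes "disjoint_digraphs \<T>" "finite S" "infinite \<T> \<or> card S < card \<T>"
  shows "\<exists>T\<in>\<T>. verts T \<inter> S = {}"
proof (rule ccontr)
  assume "\<not> ?thesis"
  then have "\<forall>T\<in>\<T>. \<exists>s. s \<in> verts T \<inter> S" by blast
  then obtain f where f: "\<forall>T\<in>\<T>. f T \<in> verts T \<inter> S" by (rule bchoice[THEN exE])
  have inj: "inj_on f \<T>"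
  proof (rule inj_onI)
    fix X Y assume "X \<in> \<T>" "Y \<in> \<T>" "f X = f Y"
    then have "f X \<in> verts X \<inter> verts Y" using f by auto
    then show "X = Y" using \<open>X \<in> \<T>\<close> \<open>Y \<in> \<T>\<close> assms(1) unfolding pairwise_def disjnt_def by blast
  qed
  have "f ` \<T> \<subseteq> S" using f by auto
  then have "finite \<T> \<and> card \<T> \<le> card S"
    using inj assms(2) by (meson inj_on_finite card_inj_on_le)
  then show False using assms(3) by auto
qed

text \<open>
  Each member is chosen disjoint from its predecessors. A digraph without vertices is disjoint
  from itself, so \<open>nonempty\<close> is what keeps the chosen members distinct.
\<close>

lemma infinite_disjoint_family:
  assumes extend: "\<And>\<F>. finite \<F> \<Longrightarrow> (\<forall>F\<in>\<F>. Q F) \<Longrightarrow> \<exists>T. Q T \<and> (\<forall>F\<in>\<F>. verts T \<inter> verts F = {})"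
    and nonempty: "\<And>T. Q T \<Longrightarrow> verts T \<noteq> {}"
  shows "\<exists>\<T>. infinite \<T> \<and> disjoint_digraphs \<T> \<and> (\<forall>T\<in>\<T>. Q T)"
proof -
  define P where "P f n T \<longleftrightarrow> Q T \<and> (\<forall>m<n. verts T \<inter> verts (f m) = {})"
    for f :: "nat \<Rightarrow> ('a,'b) pre_digraph" and n T
  have "\<exists>f. \<forall>n. P f n (f n)"
  proof (rule dependent_wellorder_choice)
    fix r and f g :: "nat \<Rightarrow> ('a,'b) pre_digraph" and n
    assume "\<And>m. m < n \<Longrightarrow> f m = g m"
    then show "P f n r = P g n r" by (simp add: P_def)
  next
    fix n and f :: "nat \<Rightarrow> ('a,'b) pre_digraph"
    assume "\<And>m. m < n \<Longrightarrow> P f m (f m)"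
    then have "\<forall>F\<in>f ` {..<n}. Q F" by (auto simp: P_def)
    then show "\<exists>r. P f n r" using extend[of "f ` {..<n}"] by (auto simp: P_def)
  qed
  then obtain f where "\<forall>n. P f n (f n)" ..
  then have f: "\<And>n. Q (f n)" "\<And>m n. m < n \<Longrightarrow> verts (f n) \<inter> verts (f m) = {}"
    by (auto simp: P_def)
  have disj: "verts (f m) \<inter> verts (f n) = {}" if "m \<noteq> n" for m n
    using f(2)[of m n] f(2)[of n m] that by (metis inf_commute nat_neq_iff)
  have "inj f"
    using disj nonempty[OF f(1)] by (metis inf.idem injI)
  then have "infinite (range f)" by (simp add: finite_image_iff)
  moreover have "disjoint_digraphs (range f)"
    unfolding pairwise_def disjnt_def using disj by (metis rangeE)
  ultimately show ?thesis using f(1) by blast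
qed

section \<open>Paths and rays as vertex sequences\<close>

text \<open>
  Indexed sequences describe paths in the same way as rays, and they are easier to cut and
  concatenate than lists of arcs.
\<close>

lemma is_path_iff:
  "is_path P u v \<longleftrightarrow> (\<exists>(n::nat) x e. inj_on x {..n} \<and> x 0 = u \<and> x n = v \<and>
      verts P = x ` {..n} \<and> arcs P = e ` {..<n} \<and>
      (\<forall>i<n. tail P (e i) = x i \<and> head P (e i) = x (Suc i)))"
proof
  assume "is_path P u v"
  then obtain p where p: "u \<in> verts P" "pre_digraph.cas P u p v" "distinct (pre_digraph.awalk_verts P u p)"
      "verts P = set (pre_digraph.awalk_verts P u p)" "arcs P = set p"
    unfolding is_path_def pre_digraph.apath_def pre_digraph.awalk_def by auto
  let ?x = "\<lambda>i. pre_digraph.awalk_verts P u p ! i"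
  let ?e = "\<lambda>i. p ! i"
  have len: "length (pre_digraph.awalk_verts P u p) = Suc (length p)" for u p
    by (induction p arbitrary: u) (auto simp: pre_digraph.awalk_verts.simps)
  have hd: "pre_digraph.awalk_verts P u p ! 0 = u" if "pre_digraph.cas P u p v" for u p
    using that by (cases p) (auto simp: pre_digraph.awalk_verts.simps pre_digraph.cas.simps)
  have lst: "pre_digraph.awalk_verts P u p ! length p = v" if "pre_digraph.cas P u p v" for u p
    using that by (induction p arbitrary: u) (auto simp: pre_digraph.awalk_verts.simps pre_digraph.cas.simps)
  have arc: "tail P (p ! i) = pre_digraph.awalk_verts P u p ! i \<and>
      head P (p ! i) = pre_digraph.awalk_verts P u p ! Suc i"
    if "pre_digraph.cas P u p v" "i < length p" for u p i
    using that
  proof (induction p arbitrary: u i)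
    case (Cons a p)
    then show ?case using hd[of "head P a" p]
      by (cases i) (auto simp: pre_digraph.awalk_verts.simps pre_digraph.cas.simps)
  qed simp
  have "inj_on ?x {..length p}"
    using p(3) by (intro inj_on_nth) (auto simp: len)
  moreover have "verts P = ?x ` {..length p}"
    unfolding p(4) by (subst set_conv_nth) (auto simp: len less_Suc_eq_le)
  moreover have "arcs P = ?e ` {..<length p}"
    unfolding p(5) by (subst set_conv_nth) auto
  ultimately show "\<exists>(n::nat) x e. inj_on x {..n} \<and> x 0 = u \<and> x n = v \<and>
      verts P = x ` {..n} \<and> arcs P = e ` {..<n} \<and>
      (\<forall>i<n. tail P (e i) = x i \<and> head P (e i) = x (Suc i))"
    using hd[OF p(2)] lst[OF p(2)] arc[OF p(2)]
    by (intro exI[of _ "length p"] exI[of _ ?x] exI[of _ ?e]) auto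
next
  assume "\<exists>(n::nat) x e. inj_on x {..n} \<and> x 0 = u \<and> x n = v \<and>
      verts P = x ` {..n} \<and> arcs P = e ` {..<n} \<and>
      (\<forall>i<n. tail P (e i) = x i \<and> head P (e i) = x (Suc i))"
  then obtain n x e where x: "inj_on x {..n::nat}" "x 0 = u" "x n = v"
      "verts P = x ` {..n}" "arcs P = e ` {..<n}"
      "\<forall>i<n. tail P (e i) = x i \<and> head P (e i) = x (Suc i)"
    by blast
  have "pre_digraph.awalk_verts P (x 0) (map e [0..<n]) = map x [0..<Suc n] \<and>
      pre_digraph.cas P (x 0) (map e [0..<n]) (x n)"
    if "\<forall>i<n. tail P (e i) = x i \<and> head P (e i) = x (Suc i)" for x e n
    using that
  proof (induction n arbitrary: x e)
    case 0
    then show ?case by (simp add: pre_digraph.awalk_verts.simps pre_digraph.cas.simps)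
  next
    case (Suc n)
    have split: "map f [0..<Suc m] = f 0 # map (\<lambda>i. f (Suc i)) [0..<m]" for f :: "nat \<Rightarrow> 'c" and m
      by (simp add: upt_conv_Cons map_Suc_upt[symmetric] comp_def del: upt_Suc)
    have "tail P (e 0) = x 0" "head P (e 0) = x (Suc 0)" using Suc.prems by auto
    with Suc.IH[of "\<lambda>i. e (Suc i)" "\<lambda>i. x (Suc i)"] Suc.prems show ?case
      unfolding split[of e] split[of x "Suc n"]
      by (simp add: pre_digraph.awalk_verts.simps pre_digraph.cas.simps del: upt_Suc)
  qed
  then have w: "pre_digraph.awalk_verts P u (map e [0..<n]) = map x [0..<Suc n]"
    "pre_digraph.cas P u (map e [0..<n]) v" using x(2,3,6) by blast+
  have up: "set [0..<Suc n] = {..n}" by auto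
  have "pre_digraph.apath P u (map e [0..<n]) v"
    unfolding pre_digraph.apath_def pre_digraph.awalk_def w(1)
    using x w(2) up by (auto simp: distinct_map simp del: upt_Suc)
  moreover have "verts P = set (pre_digraph.awalk_verts P u (map e [0..<n]))"
    unfolding w(1) x(4) set_map up ..
  moreover have "arcs P = set (map e [0..<n])" using x(5) by auto
  ultimately show "is_path P u v" unfolding is_path_def by blast
qed

lemma subgraph_arc:
  assumes "subgraph H D" "e \<in> arcs H"
  shows "(tail H e, head H e) \<in> arcs_ends D"
  using assms unfolding subgraph_def compatible_def arcs_ends_conv by auto

lemma path_in_verts:
  assumes "subgraph P D" "is_path P u v"
  obtains n :: nat and x where "inj_on x {..n}" "x 0 = u" "x n = v" "verts P = x ` {..n}"
    "\<forall>i<n. (x i, x (Suc i)) \<in> arcs_ends D"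
proof -
  from assms(2) obtain n x e where *: "inj_on x {..n::nat}" "x 0 = u" "x n = v"
      "verts P = x ` {..n}" "arcs P = e ` {..<n}"
      "\<forall>i<n. tail P (e i) = x i \<and> head P (e i) = x (Suc i)"
    unfolding is_path_iff by blast
  have "(x i, x (Suc i)) \<in> arcs_ends D" if "i < n" for i
    using subgraph_arc[OF assms(1), of "e i"] * that by auto
  with * that show thesis by blast
qed

lemma out_ray_in_verts:
  assumes "subgraph R D" "out_ray R v"
  obtains x :: "nat \<Rightarrow> 'a" where "inj x" "x 0 = v" "verts R = range x"
    "\<forall>i. (x i, x (Suc i)) \<in> arcs_ends D"
  using assms(2) unfolding out_ray_def by (metis assms(1) rangeI subgraph_arc)

lemma in_ray_in_verts:
  assumes "subgraph R D" "in_ray R v"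
  obtains x :: "nat \<Rightarrow> 'a" where "inj x" "x 0 = v" "verts R = range x"
    "\<forall>i. (x (Suc i), x i) \<in> arcs_ends D"
  using assms(2) unfolding in_ray_def by (metis assms(1) rangeI subgraph_arc)

lemma subgraph_of_arcs:
  assumes "wf_digraph D" "V \<subseteq> verts D" "E \<subseteq> arcs D" "tail D ` E \<subseteq> V" "head D ` E \<subseteq> V"
  shows "subgraph \<lparr>verts = V, arcs = E, tail = tail D, head = head D\<rparr> D"
  using assms unfolding subgraph_def compatible_def wf_digraph_def by auto

lemma arcs_ends_in_verts:
  assumes "wf_digraph D" "(u, v) \<in> arcs_ends D"
  shows "u \<in> verts D" "v \<in> verts D"
  using assms unfolding arcs_ends_conv wf_digraph_def by auto

lemma arcs_endsD:
  assumes "(u, v) \<in> arcs_ends D"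
  shows "\<exists>e. e \<in> arcs D \<and> tail D e = u \<and> head D e = v"
  using assms unfolding arcs_ends_conv by auto

text \<open>
  For disjointness, and for the end to which a ray belongs, only vertices matter. So it is enough
  to give a path or ray as a sequence of vertices; the arcs between consecutive vertices may be
  picked arbitrarily among parallel ones.
\<close>

lemma path_through:
  fixes x :: "nat \<Rightarrow> 'a"
  assumes "wf_digraph D" "x 0 \<in> verts D" "inj_on x {..n}" "\<forall>i<n. (x i, x (Suc i)) \<in> arcs_ends D"
  shows "\<exists>P. subgraph P D \<and> is_path P (x 0) (x n) \<and> verts P = x ` {..n}"
proof -
  have "\<forall>i. \<exists>e. i < n \<longrightarrow> e \<in> arcs D \<and> tail D e = x i \<and> head D e = x (Suc i)"
    using assms(4) arcs_endsD[of _ _ D] by blast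
  then obtain e where e: "\<And>i. i < n \<Longrightarrow> e i \<in> arcs D \<and> tail D (e i) = x i \<and> head D (e i) = x (Suc i)"
    by metis
  let ?P = "\<lparr>verts = x ` {..n}, arcs = e ` {..<n}, tail = tail D, head = head D\<rparr>"
  have "x i \<in> verts D" if "i \<le> n" for i
    using that assms arcs_ends_in_verts(2)[OF assms(1)] by (cases i) (auto simp: Suc_le_eq)
  then have "subgraph ?P D"
    using e by (intro subgraph_of_arcs assms) force+
  moreover have "is_path ?P (x 0) (x n)"
    unfolding is_path_iff using assms(3) e
    by (intro exI[of _ n] exI[of _ x] exI[of _ e]) auto
  ultimately show ?thesis by (intro exI[of _ ?P]) auto
qed

lemma out_ray_through:
  fixes x :: "nat \<Rightarrow> 'a"
  assumes "wf_digraph D" "inj x" "\<forall>i. (x i, x (Suc i)) \<in> arcs_ends D"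
  shows "\<exists>R. subgraph R D \<and> out_ray R (x 0) \<and> verts R = range x"
proof -
  have "\<forall>i. \<exists>e. e \<in> arcs D \<and> tail D e = x i \<and> head D e = x (Suc i)"
    using assms(3) arcs_endsD[of _ _ D] by blast
  then obtain e where e: "\<And>i. e i \<in> arcs D \<and> tail D (e i) = x i \<and> head D (e i) = x (Suc i)"
    by metis
  let ?R = "\<lparr>verts = range x, arcs = range e, tail = tail D, head = head D\<rparr>"
  have "subgraph ?R D"
    using e assms(3) arcs_ends_in_verts(1)[OF assms(1)] by (intro subgraph_of_arcs assms) force+
  moreover have "out_ray ?R (x 0)"
    unfolding out_ray_def using assms(2) e by (intro exI[of _ x] exI[of _ e]) auto
  ultimately show ?thesis by (intro exI[of _ ?R]) auto
qed

lemma in_ray_through: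
  fixes x :: "nat \<Rightarrow> 'a"
  assumes "wf_digraph D" "inj x" "\<forall>i. (x (Suc i), x i) \<in> arcs_ends D"
  shows "\<exists>R. subgraph R D \<and> in_ray R (x 0) \<and> verts R = range x"
proof -
  have "\<forall>i. \<exists>e. e \<in> arcs D \<and> tail D e = x (Suc i) \<and> head D e = x i"
    using assms(3) arcs_endsD[of _ _ D] by blast
  then obtain e where e: "\<And>i. e i \<in> arcs D \<and> tail D (e i) = x (Suc i) \<and> head D (e i) = x i"
    by metis
  let ?R = "\<lparr>verts = range x, arcs = range e, tail = tail D, head = head D\<rparr>"
  have "subgraph ?R D"
    using e assms(3) arcs_ends_in_verts(2)[OF assms(1)] by (intro subgraph_of_arcs assms) force+
  moreover have "in_ray ?R (x 0)"
    unfolding in_ray_def using assms(2) e by (intro exI[of _ x] exI[of _ e]) auto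
  ultimately show ?thesis by (intro exI[of _ ?R]) auto
qed

text \<open>
  The two rays are built from the arcs of \<open>Z\<close>: in the presence of parallel arcs, rays in
  \<open>D\<close> through the same vertices may fail to be subdigraphs of \<open>Z\<close>.
\<close>

lemma double_ray_through:
  fixes z :: "int \<Rightarrow> 'a"
  assumes "wf_digraph D" "inj z" "\<forall>i. (z i, z (i + 1)) \<in> arcs_ends D"
  obtains Z I J where "subgraph Z D" "double_ray Z" "verts Z = range z"
    "subgraph I Z" "in_ray I (z 0)" "verts I = z ` {..0}"
    "subgraph J Z" "out_ray J (z 0)" "verts J = z ` {0..}"
proof -
  have "\<forall>i. \<exists>e. e \<in> arcs D \<and> tail D e = z i \<and> head D e = z (i + 1)"
    using assms(3) arcs_endsD[of _ _ D] by blast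
  then obtain e where e: "\<And>i. e i \<in> arcs D \<and> tail D (e i) = z i \<and> head D (e i) = z (i + 1)"
    by metis
  let ?Z = "\<lparr>verts = range z, arcs = range e, tail = tail D, head = head D\<rparr>"
  have Z: "subgraph ?Z D"
    using e assms(3) arcs_ends_in_verts(1)[OF assms(1)] by (intro subgraph_of_arcs assms) force+
  then have wf: "wf_digraph ?Z" by (simp add: subgraph_def)
  have dr: "double_ray ?Z"
    unfolding double_ray_def using assms(2) e by (intro exI[of _ z] exI[of _ e]) auto
  have arc: "\<forall>i. (z i, z (i + 1)) \<in> arcs_ends ?Z"
  proof
    fix i show "(z i, z (i + 1)) \<in> arcs_ends ?Z"
      unfolding arcs_ends_conv using e by (intro image_eqI[of _ _ "e i"]) auto
  qed
  have "inj (\<lambda>i. z (- int i))" "inj (\<lambda>i. z (int i))"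
    using injD[OF assms(2)] by (force intro: injI)+
  moreover have "\<forall>i. (z (- int (Suc i)), z (- int i)) \<in> arcs_ends ?Z"
  proof
    fix i show "(z (- int (Suc i)), z (- int i)) \<in> arcs_ends ?Z"
      using arc[rule_format, of "- int (Suc i)"] by simp
  qed
  moreover have "\<forall>i. (z (int i), z (int (Suc i))) \<in> arcs_ends ?Z"
  proof
    fix i show "(z (int i), z (int (Suc i))) \<in> arcs_ends ?Z"
      using arc[rule_format, of "int i"] by (simp add: add.commute)
  qed
  ultimately obtain I J where IJ: "subgraph I ?Z" "in_ray I (z (- int 0))" "verts I = range (\<lambda>i. z (- int i))"
     "subgraph J ?Z" "out_ray J (z (int 0))" "verts J = range (\<lambda>i. z (int i))"
    using in_ray_through[OF wf, of "\<lambda>i. z (- int i)"] out_ray_through[OF wf, of "\<lambda>i. z (int i)"] by blast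
  have "{..0} = range (\<lambda>i. - int i)"
    by (auto simp: image_iff intro!: exI[of _ "nat (- _)"])
  moreover have "{0..} = range int"
    by (auto simp: image_iff intro!: exI[of _ "nat _"])
  ultimately have "verts I = z ` {..0}" "verts J = z ` {0..}"
    using IJ by (auto simp: image_image)
  with that Z dr IJ show thesis by auto
qed

section \<open>Ends\<close>

definition arcs_off :: "('a,'b) pre_digraph \<Rightarrow> 'a set \<Rightarrow> 'a rel" where
  "arcs_off D S = {(u, v) \<in> arcs_ends D. u \<notin> S \<and> v \<notin> S}"

lemma rtrancl_along:
  fixes r :: "nat \<Rightarrow> 'a"
  assumes "m \<le> k" "\<And>i. m \<le> i \<Longrightarrow> i < k \<Longrightarrow> (r i, r (Suc i)) \<in> R"
  shows "(r m, r k) \<in> R\<^sup>*"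
  using assms
proof (induction k rule: dec_induct)
  case (step n)
  then have "(r m, r n) \<in> R\<^sup>*" "(r n, r (Suc n)) \<in> R" by auto
  then show ?case by (rule rtrancl.rtrancl_into_rtrancl)
qed simp

text \<open>
  A shortest walk avoiding \<open>S\<close> from \<open>X\<close> to \<open>Y\<close> repeats no vertex, and meets
  \<open>X\<close> only at its start and \<open>Y\<close> only at its end.
\<close>

lemma set_path_if_reachable:
  assumes "wf_digraph D" "x \<in> X" "y \<in> Y" "(x, y) \<in> (arcs_off D S)\<^sup>*" "x \<in> verts D" "x \<notin> S"
  shows "\<exists>P. set_path D X Y P \<and> verts P \<inter> S = {}"
proof -
  define good where
    "good n \<longleftrightarrow> (\<exists>x\<in>X \<inter> verts D - S. \<exists>y\<in>Y. (x, y) \<in> arcs_off D S ^^ n)" for n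
  have "\<exists>n. good n" using assms unfolding good_def by (blast dest: rtrancl_imp_relpow)
  then obtain n where n: "good n" "\<And>m. m < n \<Longrightarrow> \<not> good m"
    using LeastI_ex[of good] not_less_Least[of _ good] by metis
  from n(1) obtain f where f: "f 0 \<in> X \<inter> verts D - S" "f n \<in> Y"
      "\<forall>i<n. (f i, f (Suc i)) \<in> arcs_off D S"
    unfolding good_def relpow_fun_conv by blast
  have off: "f i \<notin> S" if "i \<le> n" for i
    using that f by (cases i) (auto simp: arcs_off_def)
  have inD: "f i \<in> verts D" if "i \<le> n" for i
    using that f arcs_ends_in_verts(2)[OF assms(1)] by (cases i) (auto simp: arcs_off_def Suc_le_eq)
  have shortcut: False if "(f 0, f i) \<in> arcs_off D S ^^ i" "i < j" "j \<le> n" "f i = f j" for i j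
  proof -
    have "(f j, f n) \<in> arcs_off D S ^^ (n - j)"
      unfolding relpow_fun_conv using f(3) that by (intro exI[of _ "\<lambda>k. f (j + k)"]) auto
    then have "(f 0, f n) \<in> arcs_off D S ^^ (i + (n - j))"
      unfolding relpow_add using that by (auto intro: relcompI)
    then have "good (i + (n - j))" using f unfolding good_def by blast
    with n(2)[of "i + (n - j)"] that show False by auto
  qed
  have pre: "(f 0, f i) \<in> arcs_off D S ^^ i" if "i \<le> n" for i
    unfolding relpow_fun_conv using f(3) that by auto
  have inj: "inj_on f {..n}"
    using shortcut pre by (intro linorder_inj_onI') (metis atMost_iff)
  have "i = 0" if "i \<le> n" "f i \<in> X" for i
  proof -
    have "(f i, f n) \<in> arcs_off D S ^^ (n - i)"
      unfolding relpow_fun_conv using f(3) that by (intro exI[of _ "\<lambda>k. f (i + k)"]) auto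
    then have "good (n - i)" using f that off[OF that(1)] inD[OF that(1)] unfolding good_def by blast
    then show ?thesis using n(2)[of "n - i"] that by linarith
  qed
  then have meetX: "f ` {..n} \<inter> X = {f 0}" using f by auto
  have "i = n" if "i \<le> n" "f i \<in> Y" for i
  proof -
    have "good i" using pre[OF that(1)] that f unfolding good_def by blast
    then show ?thesis using n(2)[of i] that by linarith
  qed
  then have meetY: "f ` {..n} \<inter> Y = {f n}" using f by auto
  obtain P where "subgraph P D" "is_path P (f 0) (f n)" "verts P = f ` {..n}"
    using path_through[OF assms(1) _ inj] f by (auto simp: arcs_off_def)
  then show ?thesis using meetX meetY off unfolding set_path_def
    by (intro exI[of _ P]) auto
qed

lemma reachable_if_set_path:
  assumes "set_path D X Y P" "verts P \<inter> S = {}"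
  obtains u v where "u \<in> X" "v \<in> Y" "u \<in> verts P" "v \<in> verts P" "(u, v) \<in> (arcs_off D S)\<^sup>*"
proof -
  from assms(1) obtain u v where P: "subgraph P D" "is_path P u v" "verts P \<inter> X = {u}" "verts P \<inter> Y = {v}"
    unfolding set_path_def by blast
  obtain n x where x: "inj_on x {..n::nat}" "x 0 = u" "x n = v" "verts P = x ` {..n}"
    "\<forall>i<n. (x i, x (Suc i)) \<in> arcs_ends D" using path_in_verts[OF P(1,2)] by blast
  have "(x 0, x n) \<in> (arcs_off D S)\<^sup>*"
  proof (rule rtrancl_along)
    fix i assume "i < n"
    then have "x i \<in> verts P" "x (Suc i) \<in> verts P" using x(4) by auto
    then show "(x i, x (Suc i)) \<in> arcs_off D S"
      using x(5) \<open>i < n\<close> assms(2) unfolding arcs_off_def by blast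
  qed simp
  then show thesis using that[of u v] P x by auto
qed

text \<open>
  Paths are finite, so infinitely many disjoint ones can be found greedily as soon as no finite
  set separates the two rays. In contrast to families of disjoint paths, reachability outside a
  finite set composes easily.
\<close>

lemma inf_many_paths_iff:
  assumes "wf_digraph D"
  shows "inf_many_paths D R\<^sub>1 R\<^sub>2 \<longleftrightarrow> (\<forall>S. finite S \<longrightarrow>
    (\<exists>x\<in>verts R\<^sub>1 \<inter> verts D - S. \<exists>y\<in>verts R\<^sub>2. (x, y) \<in> (arcs_off D S)\<^sup>*))"
    (is "_ \<longleftrightarrow> ?R")
proof
  assume "inf_many_paths D R\<^sub>1 R\<^sub>2"
  then obtain \<P> where P: "infinite \<P>" "disjoint_digraphs \<P>" "\<forall>P\<in>\<P>. set_path D (verts R\<^sub>1) (verts R\<^sub>2) P"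
    unfolding inf_many_paths_def by blast
  show ?R
  proof (intro allI impI)
    fix S :: "'a set" assume "finite S"
    then obtain P where "P \<in> \<P>" "verts P \<inter> S = {}"
      using disjoint_member_avoiding[OF P(2)] P(1) by blast
    moreover have "verts P \<subseteq> verts D" using P(3) \<open>P \<in> \<P>\<close> by (auto simp: set_path_def subgraph_def)
    moreover obtain u v where "u \<in> verts R\<^sub>1" "v \<in> verts R\<^sub>2" "u \<in> verts P" "(u, v) \<in> (arcs_off D S)\<^sup>*"
      using reachable_if_set_path P(3) calculation by metis
    ultimately show "\<exists>x\<in>verts R\<^sub>1 \<inter> verts D - S. \<exists>y\<in>verts R\<^sub>2. (x, y) \<in> (arcs_off D S)\<^sup>*"
      by blast
  qed
next
  assume R: ?R
  show "inf_many_paths D R\<^sub>1 R\<^sub>2"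
    unfolding inf_many_paths_def
  proof (rule infinite_disjoint_family)
    fix \<F> assume F: "finite \<F>" "\<forall>F\<in>\<F>. set_path D (verts R\<^sub>1) (verts R\<^sub>2) F"
    have "finite (verts F)" if "F \<in> \<F>" for F
      using F(2) that unfolding set_path_def is_path_def by auto
    then have "finite (\<Union>F\<in>\<F>. verts F)" using F(1) by blast
    then obtain x y where "x \<in> verts R\<^sub>1 \<inter> verts D - (\<Union>F\<in>\<F>. verts F)" "y \<in> verts R\<^sub>2"
      "(x, y) \<in> (arcs_off D (\<Union>F\<in>\<F>. verts F))\<^sup>*" using R by blast
    then show "\<exists>T. set_path D (verts R\<^sub>1) (verts R\<^sub>2) T \<and> (\<forall>F\<in>\<F>. verts T \<inter> verts F = {})"
      using set_path_if_reachable[OF assms, of x "verts R\<^sub>1" y "verts R\<^sub>2" "\<Union>F\<in>\<F>. verts F"] by blast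
  qed (auto simp: set_path_def)
qed

lemma inf_many_paths_if_infinite_inter:
  assumes "wf_digraph D" "R \<in> rays D" "infinite (verts R \<inter> verts R')"
  shows "inf_many_paths D R R'"
  unfolding inf_many_paths_iff[OF assms(1)]
proof (intro allI impI)
  fix S :: "'a set" assume "finite S"
  then obtain x where "x \<in> verts R \<inter> verts R' - S"
    using assms(3) by (metis Diff_infinite_finite ex_in_conv finite.emptyI)
  moreover have "verts R \<subseteq> verts D" using assms(2) by (auto simp: rays_def subgraph_def)
  ultimately show "\<exists>x\<in>verts R \<inter> verts D - S. \<exists>y\<in>verts R'. (x, y) \<in> (arcs_off D S)\<^sup>*"
    by blast
qed

lemma infinite_ray:
  assumes "R \<in> rays D"
  shows "infinite (verts R)"
  using assms unfolding rays_def in_ray_def out_ray_def by (auto dest: finite_imageD)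

lemma finite_indices:
  fixes r :: "nat \<Rightarrow> 'a"
  assumes "inj r" "finite S"
  obtains N where "\<And>i. i \<ge> N \<Longrightarrow> r i \<notin> S"
proof -
  have "finite (r -` S)" by (rule finite_vimageI[OF assms(2,1)])
  then obtain N where "r -` S \<subseteq> {..<N}" using finite_nat_bounded by blast
  then have "r i \<notin> S" if "i \<ge> N" for i using that by fastforce
  then show thesis by (rule that)
qed

text \<open>
  A walk from \<open>R\<^sub>1\<close> reaches \<open>R\<^sub>2\<close> at some vertex \<open>r m\<close>, and a walk to \<open>R\<^sub>3\<close>
  leaves \<open>R\<^sub>2\<close> at some vertex \<open>r k\<close>. Both can be chosen beyond the finite set
  \<open>S\<close>, and the one chosen second can be chosen beyond the other. For an out-ray \<open>k\<close> is
  chosen second and for an in-ray \<open>m\<close>, so that \<open>R\<^sub>2\<close> leads from \<open>r m\<close> to \<open>r k\<close>.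
\<close>

lemma inf_many_paths_trans:
  assumes "wf_digraph D" "R\<^sub>2 \<in> rays D" "inf_many_paths D R\<^sub>1 R\<^sub>2" "inf_many_paths D R\<^sub>2 R\<^sub>3"
  shows "inf_many_paths D R\<^sub>1 R\<^sub>3"
  unfolding inf_many_paths_iff[OF assms(1)]
proof (intro allI impI)
  fix S :: "'a set" assume S: "finite S"
  note P12 = assms(3)[unfolded inf_many_paths_iff[OF assms(1)], rule_format]
  note P23 = assms(4)[unfolded inf_many_paths_iff[OF assms(1)], rule_format]
  have fin: "finite (S \<union> r ` {..<N})" for r :: "nat \<Rightarrow> 'a" and N
    using S by simp
  have mono: "(x, y) \<in> (arcs_off D S)\<^sup>*" if "(x, y) \<in> (arcs_off D (S \<union> S'))\<^sup>*" for x y S'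
    using that rtrancl_mono[of "arcs_off D (S \<union> S')" "arcs_off D S"] by (auto simp: arcs_off_def)
  have end_off: "y \<notin> S" if "x \<notin> S" "(x, y) \<in> (arcs_off D S)\<^sup>*" for x y S
    using that(2,1) by (induction) (auto simp: arcs_off_def)
  obtain v where "subgraph R\<^sub>2 D" and "in_ray R\<^sub>2 v \<or> out_ray R\<^sub>2 v"
    using assms(2) unfolding rays_def by blast
  then consider (out) r where "inj r" "verts R\<^sub>2 = range r" "\<forall>i::nat. (r i, r (Suc i)) \<in> arcs_ends D"
    | (inn) r where "inj r" "verts R\<^sub>2 = range r" "\<forall>i::nat. (r (Suc i), r i) \<in> arcs_ends D"
    using out_ray_in_verts in_ray_in_verts by metis
  then show "\<exists>x\<in>verts R\<^sub>1 \<inter> verts D - S. \<exists>y\<in>verts R\<^sub>3. (x, y) \<in> (arcs_off D S)\<^sup>*"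
  proof cases
    case out
    obtain N where N: "\<And>i. i \<ge> N \<Longrightarrow> r i \<notin> S" using finite_indices[OF out(1) S] by blast
    obtain x m where x: "x \<in> verts R\<^sub>1 \<inter> verts D - (S \<union> r ` {..<N})" "(x, r m) \<in> (arcs_off D (S \<union> r ` {..<N}))\<^sup>*"
      using P12[OF fin[of r N]] unfolding out(2) by blast
    have "N \<le> m" using end_off[OF _ x(2)] x(1) by (metis DiffD2 UnI2 imageI lessThan_iff not_less)
    obtain k y where y: "r k \<notin> S \<union> r ` {..<m}" "y \<in> verts R\<^sub>3" "(r k, y) \<in> (arcs_off D (S \<union> r ` {..<m}))\<^sup>*"
      using P23[OF fin[of r m]] unfolding out(2) by blast
    have "m \<le> k" using y(1) by (metis UnI2 imageI lessThan_iff not_less)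
    then have "(r m, r k) \<in> (arcs_off D S)\<^sup>*"
      using N out(3) \<open>N \<le> m\<close> by (intro rtrancl_along) (auto simp: arcs_off_def)
    then have "(x, y) \<in> (arcs_off D S)\<^sup>*" using mono[OF x(2)] mono[OF y(3)] by (meson rtrancl_trans)
    then show ?thesis using x y by blast
  next
    case inn
    obtain N where N: "\<And>i. i \<ge> N \<Longrightarrow> r i \<notin> S" using finite_indices[OF inn(1) S] by blast
    obtain k y where y: "r k \<notin> S \<union> r ` {..<N}" "y \<in> verts R\<^sub>3" "(r k, y) \<in> (arcs_off D (S \<union> r ` {..<N}))\<^sup>*"
      using P23[OF fin[of r N]] unfolding inn(2) by blast
    have "N \<le> k" using y(1) by (metis UnI2 imageI lessThan_iff not_less)
    obtain x m where x: "x \<in> verts R\<^sub>1 \<inter> verts D - (S \<union> r ` {..<k})" "(x, r m) \<in> (arcs_off D (S \<union> r ` {..<k}))\<^sup>*"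
      using P12[OF fin[of r k]] unfolding inn(2) by blast
    have "k \<le> m" using end_off[OF _ x(2)] x(1) by (metis DiffD2 UnI2 imageI lessThan_iff not_less)
    then have "(r k, r m) \<in> ((arcs_off D S)\<inverse>)\<^sup>*"
      using N inn(3) \<open>N \<le> k\<close> by (intro rtrancl_along) (auto simp: arcs_off_def)
    then have "(r m, r k) \<in> (arcs_off D S)\<^sup>*" by (simp add: rtrancl_converse)
    then have "(x, y) \<in> (arcs_off D S)\<^sup>*" using mono[OF x(2)] mono[OF y(3)] by (meson rtrancl_trans)
    then show ?thesis using x y by blast
  qed
qed

lemma equiv_ray_equiv:
  assumes "wf_digraph D"
  shows "equiv (rays D) (ray_equiv D)"
proof (rule equivI)
  show "refl_on (rays D) (ray_equiv D)"
    using inf_many_paths_if_infinite_inter[OF assms] infinite_ray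
    by (intro refl_onI) (fastforce simp: ray_equiv_def)+
  show "trans (ray_equiv D)"
    using inf_many_paths_trans[OF assms] by (intro transI) (auto simp: ray_equiv_def)
qed (auto simp: ray_equiv_def intro!: symI)

text \<open>
  The paths that consist of a single common vertex of the two rays make them equivalent.
\<close>

lemma end_contains_ray:
  assumes "wf_digraph D" "a \<in> ends D" "R \<in> a" "R' \<in> rays D" "infinite (verts R \<inter> verts R')"
  shows "R' \<in> a"
proof -
  note eq = equiv_ray_equiv[OF assms(1)]
  have "R \<in> rays D" using assms(2,3) in_quotient_imp_subset[OF eq] by (auto simp: ends_def)
  then have "(R, R') \<in> ray_equiv D"
    using assms inf_many_paths_if_infinite_inter[OF assms(1)]
    by (auto simp: ray_equiv_def Int_commute)
  then show ?thesis using in_quotient_imp_closed[OF eq] assms(2,3) by (auto simp: ends_def)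
qed

lemma ends_eq:
  assumes "wf_digraph D" "a \<in> ends D" "b \<in> ends D" "R \<in> a" "R \<in> b"
  shows "a = b"
  using quotient_disj[OF equiv_ray_equiv[OF assms(1)]] assms(2-) by (auto simp: ends_def)

section \<open>Approaching a vertex along a track\<close>

lemma double_ray_in_verts:
  assumes "subgraph T D" "double_ray T"
  obtains y :: "int \<Rightarrow> 'a" where "inj y" "verts T = range y"
    "\<forall>i. (y i, y (i + 1)) \<in> arcs_ends D" "arcs_ends T \<subseteq> range (\<lambda>i. (y i, y (i + 1)))"
proof -
  obtain y :: "int \<Rightarrow> 'a" and e where y: "inj y" "verts T = range y" "arcs T = range e"
    "\<forall>i. tail T (e i) = y i \<and> head T (e i) = y (i + 1)"
    using assms(2) unfolding double_ray_def by blast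
  have "(y i, y (i + 1)) \<in> arcs_ends D" for i
    using subgraph_arc[OF assms(1), of "e i"] y(3,4) by auto
  moreover have "arcs_ends T \<subseteq> range (\<lambda>i. (y i, y (i + 1)))"
    using y(3,4) by (auto simp: arcs_ends_conv)
  ultimately show thesis using that y by blast
qed

lemma in_ray_in_double_ray:
  fixes y :: "int \<Rightarrow> 'a"
  assumes "inj y" "arcs_ends T \<subseteq> range (\<lambda>i. (y i, y (i + 1)))" "subgraph I T" "in_ray I v"
  obtains c where "verts I = y ` {..c}"
proof -
  obtain s :: "nat \<Rightarrow> 'a" where s: "verts I = range s" "\<forall>n. (s (Suc n), s n) \<in> arcs_ends T"
    using in_ray_in_verts[OF assms(3,4)] by metis
  have step: "\<exists>i. s (Suc n) = y i \<and> s n = y (i + 1)" for n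
    using s(2) assms(2) by blast
  then obtain c where c: "s 0 = y c" by blast
  have sy: "s n = y (c - int n)" for n
  proof (induction n)
    case (Suc n)
    obtain i where i: "s (Suc n) = y i" "s n = y (i + 1)" using step by blast
    then have "i + 1 = c - int n" using Suc injD[OF assms(1)] by metis
    then have "i = c - int (Suc n)" by simp
    then show ?case using i(1) by simp
  qed (simp add: c)
  have "{..c} = range (\<lambda>n. c - int n)"
    by (auto simp: image_iff intro!: exI[of _ "nat (c - _)"])
  then have "verts I = y ` {..c}" unfolding s(1) by (auto simp: sy image_image)
  then show thesis by (rule that)
qed

lemma out_ray_in_double_ray:
  fixes y :: "int \<Rightarrow> 'a"
  assumes "inj y" "arcs_ends T \<subseteq> range (\<lambda>i. (y i, y (i + 1)))" "subgraph J T" "out_ray J v"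
  obtains c where "verts J = y ` {c..}"
proof -
  obtain s :: "nat \<Rightarrow> 'a" where s: "verts J = range s" "\<forall>n. (s n, s (Suc n)) \<in> arcs_ends T"
    using out_ray_in_verts[OF assms(3,4)] by metis
  have step: "\<exists>i. s n = y i \<and> s (Suc n) = y (i + 1)" for n
    using s(2) assms(2) by blast
  then obtain c where c: "s 0 = y c" by blast
  have sy: "s n = y (c + int n)" for n
  proof (induction n)
    case (Suc n)
    obtain i where i: "s n = y i" "s (Suc n) = y (i + 1)" using step by blast
    then have "i = c + int n" using Suc injD[OF assms(1)] by metis
    then show ?case using i(2) by (simp add: ac_simps)
  qed (simp add: c)
  have "{c..} = range (\<lambda>n. c + int n)"
    by (auto simp: image_iff intro!: exI[of _ "nat (_ - c)"])
  then have "verts J = y ` {c..}" unfolding s(1) by (auto simp: sy image_image)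
  then show thesis by (rule that)
qed

lemma parts_single_end [simp]:
  "vertex_part {Inr a} = {}" "end_part {Inr a} = {a}"
  by auto

lemma track_cases:
  assumes "track D A B T"
  obtains (path) "set_path D (vertex_part A) (vertex_part B) T"
    | (in_ray) v a where "in_ray T v" "a \<in> end_part A" "T \<in> a" "v \<in> vertex_part B"
        "(verts T - {v}) \<inter> (vertex_part A \<union> vertex_part B) = {}"
    | (out_ray) v b where "out_ray T v" "v \<in> vertex_part A" "b \<in> end_part B" "T \<in> b"
        "(verts T - {v}) \<inter> (vertex_part A \<union> vertex_part B) = {}"
    | (double_ray) I v a J w b where "double_ray T"
        "subgraph I T" "in_ray I v" "a \<in> end_part A" "I \<in> a"
        "subgraph J T" "out_ray J w" "b \<in> end_part B" "J \<in> b"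
        "verts T \<inter> (vertex_part A \<union> vertex_part B) = {}"
  using assms[unfolded track_def]
  by (elim conjE disjE exE bexE) ((rule path, assumption), (rule in_ray; assumption),
      (rule out_ray; assumption), (rule double_ray; assumption))

lemma in_ray_trackI:
  assumes "subgraph T D" "in_ray T v" "a \<in> end_part A" "T \<in> a" "v \<in> vertex_part B"
    "(verts T - {v}) \<inter> (vertex_part A \<union> vertex_part B) = {}"
  shows "track D A B T"
  unfolding track_def
  by (rule conjI[OF assms(1)], rule disjI2, rule disjI1, rule exI[of _ v])
    (intro conjI bexI[of _ a] assms)

lemma out_ray_trackI:
  assumes "subgraph T D" "out_ray T v" "v \<in> vertex_part A" "b \<in> end_part B" "T \<in> b"
    "(verts T - {v}) \<inter> (vertex_part A \<union> vertex_part B) = {}"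
  shows "track D A B T"
  unfolding track_def
  by (rule conjI[OF assms(1)], rule disjI2, rule disjI2, rule disjI1, rule exI[of _ v])
    (intro conjI bexI[of _ b] assms)

lemma double_ray_trackI:
  assumes "subgraph T D" "double_ray T" "subgraph I T" "in_ray I v" "a \<in> end_part A" "I \<in> a"
    "subgraph J T" "out_ray J w" "b \<in> end_part B" "J \<in> b"
    "verts T \<inter> (vertex_part A \<union> vertex_part B) = {}"
  shows "track D A B T"
proof -
  have "\<exists>I v. subgraph I T \<and> in_ray I v \<and> (\<exists>a\<in>end_part A. I \<in> a)"
    by (rule exI[of _ I], rule exI[of _ v]) (intro conjI bexI[of _ a] assms)
  moreover have "\<exists>J w. subgraph J T \<and> out_ray J w \<and> (\<exists>b\<in>end_part B. J \<in> b)"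
    by (rule exI[of _ J], rule exI[of _ w]) (intro conjI bexI[of _ b] assms)
  ultimately show ?thesis unfolding track_def using assms(1,2,11) by (intro conjI disjI2)
qed

text \<open>
  Walking along \<open>P\<close> from its beginning to \<open>w\<close>: either the walk starts at a vertex of
  \<open>A\<close>, or it comes from an end \<open>a\<close> of \<open>A\<close>. In the second case it is listed backwards
  from \<open>w\<close>. There \<open>I\<close> is an in-ray in \<open>P\<close> that witnesses membership in \<open>a\<close>; it
  shares all but finitely many of its vertices with the walk.
\<close>

lemma track_approaching:
  fixes D :: "('a,'b) pre_digraph"
  assumes "track D A B P" "w \<in> verts P"
  obtains (from_vertex) x and m :: nat where "inj_on x {..m}" "x 0 \<in> vertex_part A"
      "x ` {1..m} \<inter> vertex_part A = {}" "x ` {..m} \<subseteq> verts P"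
      "\<forall>i<m. (x i, x (Suc i)) \<in> arcs_ends D" "x m = w"
    | (from_end) x :: "nat \<Rightarrow> 'a" and a I where "a \<in> end_part A" "I \<in> a" "infinite (verts I \<inter> range x)"
      "inj x" "x 0 = w" "range x \<subseteq> verts P" "\<forall>i. (x (Suc i), x i) \<in> arcs_ends D"
      "x ` {1..} \<inter> vertex_part A = {}" "track D {Inr a} B P"
proof -
  have sub: "subgraph P D" using assms(1) by (simp add: track_def)
  show thesis
    using assms(1)
  proof (cases rule: track_cases)
    case path
    then obtain u v where path: "is_path P u v" "verts P \<inter> vertex_part A = {u}"
      unfolding set_path_def by blast
    obtain n :: nat and x where x: "inj_on x {..n}" "x 0 = u" "verts P = x ` {..n}"
      "\<forall>i<n. (x i, x (Suc i)) \<in> arcs_ends D" using path_in_verts[OF sub path(1)] by blast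
    obtain m where m: "m \<le> n" "w = x m" using assms(2) x(3) by auto
    have "x i \<noteq> u" if "i \<in> {1..m}" for i
      using inj_onD[OF x(1), of i 0] x(2) that m(1) by auto
    moreover have "x ` {1..m} \<subseteq> verts P" using x(3) m(1) by auto
    ultimately have "x ` {1..m} \<inter> vertex_part A = {}" using path(2) by blast
    moreover have "inj_on x {..m}" using x(1) m(1) by (auto intro: inj_on_subset)
    moreover have "x 0 \<in> vertex_part A" "x ` {..m} \<subseteq> verts P" using path(2) x(2,3) m(1) by auto
    ultimately show thesis using from_vertex[of x m] x(4) m by auto
  next
    case inn: (in_ray v a)
    obtain s :: "nat \<Rightarrow> 'a" where s: "inj s" "s 0 = v" "verts P = range s"
      "\<forall>i. (s (Suc i), s i) \<in> arcs_ends D" using in_ray_in_verts[OF sub inn(1)] by blast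
    obtain i where i: "w = s i" using assms(2) s(3) by auto
    let ?x = "\<lambda>j. s (i + j)"
    have "inj ?x" using injD[OF s(1)] by (force intro: injI)
    moreover from this have "infinite (verts P \<inter> range ?x)"
      using s(3) range_inj_infinite[of ?x] by (metis Int_absorb1 image_subset_iff rangeI)
    moreover have "?x ` {1..} \<inter> vertex_part A = {}"
    proof -
      have "s (i + j) \<noteq> v" if "j \<ge> 1" for j using injD[OF s(1), of "i + j" 0] s(2) that by auto
      then have "?x ` {1..} \<subseteq> verts P - {v}" using s(3) by auto
      then show ?thesis using inn(5) by blast
    qed
    moreover have "track D {Inr a} B P"
      using inn by (intro in_ray_trackI[OF sub inn(1)]) auto
    ultimately show thesis using from_end[of a P ?x] inn(2,3) s(3,4) i by auto
  next
    case out: (out_ray v b)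
    obtain s :: "nat \<Rightarrow> 'a" where s: "inj s" "s 0 = v" "verts P = range s"
      "\<forall>i. (s i, s (Suc i)) \<in> arcs_ends D" using out_ray_in_verts[OF sub out(1)] by blast
    obtain m where m: "w = s m" using assms(2) s(3) by auto
    have "s j \<noteq> v" if "j \<in> {1..m}" for j using injD[OF s(1), of j 0] s(2) that by auto
    then have "s ` {1..m} \<subseteq> verts P - {v}" using s(3) by blast
    then have "s ` {1..m} \<inter> vertex_part A = {}" using out(5) by blast
    moreover have "inj_on s {..m}" using s(1) by (rule inj_on_subset) simp
    moreover have "s 0 \<in> vertex_part A" "s ` {..m} \<subseteq> verts P" using out(2) s(2,3) by auto
    ultimately show thesis using from_vertex[of s m] s(4) m by auto
  next
    case double: (double_ray I v a J v' b)
    obtain y :: "int \<Rightarrow> 'a" where y: "inj y" "verts P = range y"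
      "\<forall>i. (y i, y (i + 1)) \<in> arcs_ends D" "arcs_ends P \<subseteq> range (\<lambda>i. (y i, y (i + 1)))"
      using double_ray_in_verts[OF sub double(1)] by blast
    obtain c where c: "verts I = y ` {..c}" using in_ray_in_double_ray[OF y(1,4) double(2,3)] by metis
    obtain i where i: "w = y i" using assms(2) y(2) by auto
    let ?x = "\<lambda>j. y (i - int j)"
    have "inj ?x" using injD[OF y(1)] by (force intro: injI)
    moreover have "infinite (verts I \<inter> range ?x)"
    proof -
      have "y ` {..min c i} \<subseteq> verts I \<inter> range ?x"
      proof
        fix v assume "v \<in> y ` {..min c i}"
        then obtain j where "v = y j" "j \<le> c" "j \<le> i" by auto
        then have "v = ?x (nat (i - j))" "v \<in> verts I" using c by auto
        then show "v \<in> verts I \<inter> range ?x" by blast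
      qed
      moreover have "infinite (y ` {..min c i})"
        using y(1) infinite_Iic[of "min c i"] by (metis finite_imageD inj_on_subset subset_UNIV)
      ultimately show ?thesis by (meson finite_subset)
    qed
    moreover have "(?x (Suc j), ?x j) \<in> arcs_ends D" for j
      using y(3)[rule_format, of "i - int (Suc j)"] by simp
    moreover have "?x ` {1..} \<inter> vertex_part A = {}" using double(10) y(2) by auto
    moreover have "track D {Inr a} B P"
      using double by (intro double_ray_trackI[OF sub double(1,2,3) _ _ double(6-9)]) auto
    ultimately show thesis using from_end[of a I ?x] double(4,5) y(2) i by auto
  qed
qed

section \<open>Finite guards\<close>

definition guarded ::
    "('a,'b) pre_digraph \<Rightarrow> ('a,'b) verts_ends \<Rightarrow> ('a,'b) verts_ends \<Rightarrow> 'a set \<Rightarrow> bool" where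
  "guarded D A B X \<longleftrightarrow>
     (\<exists>S. finite S \<and> (\<forall>T. track D A B T \<longrightarrow> verts T \<inter> X \<noteq> {} \<longrightarrow> verts T \<inter> S \<noteq> {}))"

lemma guardedI:
  assumes "finite S" "\<And>T. track D A B T \<Longrightarrow> verts T \<inter> X \<noteq> {} \<Longrightarrow> verts T \<inter> S \<noteq> {}"
  shows "guarded D A B X"
  unfolding guarded_def using assms by (intro exI[of _ S]) simp

lemma dispersed_guard:
  assumes "dispersed D A B"
  shows "a \<in> end_part A \<Longrightarrow> \<exists>S. finite S \<and> (\<forall>T. track D {Inr a} B T \<longrightarrow> verts T \<inter> S \<noteq> {})"
    and "b \<in> end_part B \<Longrightarrow> \<exists>S. finite S \<and> (\<forall>T. track D A {Inr b} T \<longrightarrow> verts T \<inter> S \<noteq> {})"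
proof -
  show "\<exists>S. finite S \<and> (\<forall>T. track D {Inr a} B T \<longrightarrow> verts T \<inter> S \<noteq> {})" if "a \<in> end_part A"
    using bspec[OF conjunct1[OF assms[unfolded dispersed_def]] that] unfolding track_avoiding_def by meson
  show "\<exists>S. finite S \<and> (\<forall>T. track D A {Inr b} T \<longrightarrow> verts T \<inter> S \<noteq> {})" if "b \<in> end_part B"
    using bspec[OF conjunct2[OF assms[unfolded dispersed_def]] that] unfolding track_avoiding_def by meson
qed

lemma guarded_Un:
  assumes "guarded D A B X" "guarded D A B Y"
  shows "guarded D A B (X \<union> Y)"
proof -
  obtain S S' where "finite S" "\<forall>T. track D A B T \<longrightarrow> verts T \<inter> X \<noteq> {} \<longrightarrow> verts T \<inter> S \<noteq> {}"
    "finite S'" "\<forall>T. track D A B T \<longrightarrow> verts T \<inter> Y \<noteq> {} \<longrightarrow> verts T \<inter> S' \<noteq> {}"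
    using assms unfolding guarded_def by blast
  then show ?thesis unfolding guarded_def by (intro exI[of _ "S \<union> S'"]) blast
qed

lemma guarded_finite: "finite X \<Longrightarrow> guarded D A B X"
  unfolding guarded_def by blast

lemma guarded_subset: "guarded D A B Y \<Longrightarrow> X \<subseteq> Y \<Longrightarrow> guarded D A B X"
  unfolding guarded_def by blast

text \<open>
  If a track \<open>T\<close> has a first vertex \<open>x i = r k\<close> in the tail \<open>W\<close> of \<open>R\<close>, the part of
  \<open>T\<close> up to this vertex followed by the rest of \<open>R\<close> is again a track. It ends in \<open>b\<close>
  because it shares a tail with \<open>R\<close>. Otherwise \<open>T\<close> comes from \<open>b\<close> itself. The startvertex
  \<open>v\<close> may lie in \<open>A\<close>, as the startvertex of a track may.
\<close>

lemma guarded_out_ray: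
  fixes D :: "('a,'b) pre_digraph"
  assumes wf: "wf_digraph D" and ends: "end_part A \<subseteq> ends D" "end_part B \<subseteq> ends D"
    and disp: "dispersed D A B"
    and R: "subgraph R D" "out_ray R v" "R \<in> b" "b \<in> end_part B" "(verts R - {v}) \<inter> vertex_part A = {}"
  shows "guarded D A B (verts R)"
proof -
  obtain S1 where S1: "finite S1" "\<And>T. track D A {Inr b} T \<Longrightarrow> verts T \<inter> S1 \<noteq> {}"
    using dispersed_guard(2)[OF disp R(4)] by blast
  obtain S2 where S2: "finite S2"
      "\<And>T. b \<in> end_part A \<Longrightarrow> track D {Inr b} B T \<Longrightarrow> verts T \<inter> S2 \<noteq> {}"
  proof (cases "b \<in> end_part A")
    case True
    then show thesis using that dispersed_guard(1)[OF disp True] by blast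
  next
    case False
    show thesis by (rule that[of "{}"]) (use False in auto)
  qed
  obtain r :: "nat \<Rightarrow> 'a" where r: "inj r" "r 0 = v" "verts R = range r"
    "\<forall>i. (r i, r (Suc i)) \<in> arcs_ends D" using out_ray_in_verts[OF R(1,2)] by blast
  obtain M where M: "\<And>i. i \<ge> M \<Longrightarrow> r i \<notin> S1" using finite_indices[OF r(1) S1(1)] by blast
  \<comment> \<open>The successor keeps \<open>r 0 = v\<close>, which may lie in \<open>A\<close>, out of \<open>W\<close>.\<close>
  define N where "N = Suc M"
  define W where "W = r ` {N..}"
  have WS1: "W \<inter> S1 = {}" using M unfolding W_def N_def by auto
  have WA: "W \<inter> vertex_part A = {}"
  proof -
    have "r i \<noteq> v" if "i \<ge> N" for i using injD[OF r(1), of i 0] r(2) that by (auto simp: N_def)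
    then have "W \<subseteq> verts R - {v}" unfolding W_def r(3) by auto
    then show ?thesis using R(5) by blast
  qed
  have inf_tail: "infinite (range (\<lambda>n. r (k + Suc n)))" for k
    using injD[OF r(1)] by (intro range_inj_infinite injI) force
  have no_hit: False if T: "track D A B T" "w \<in> verts T" "w \<in> W" "verts T \<inter> S1 = {}" "verts T \<inter> S2 = {}" for T w
    using T(1,2)
  proof (cases rule: track_approaching)
    case (from_vertex x m)
    define i where "i = (LEAST i. x i \<in> W)"
    have "x m \<in> W" using from_vertex(6) T(3) by simp
    then have i: "x i \<in> W" "i \<le> m" unfolding i_def by (rule LeastI, rule Least_le)
    have first: "x j \<notin> W" if "j < i" for j using that unfolding i_def by (rule not_less_Least)
    obtain k where k: "x i = r k" "k \<ge> N" using i(1) by (auto simp: W_def)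
    define z where "z j = (if j \<le> i then x j else r (k + (j - i)))" for j
    have tailW: "r (k + j) \<in> W" for j using k(2) by (simp add: W_def)
    have "z p \<noteq> z q" if "p < q" for p q
    proof -
      consider "q \<le> i" | "p \<le> i" "i < q" | "i < p" using \<open>p < q\<close> by linarith
      then show ?thesis
      proof cases
        case 1
        then show ?thesis using inj_onD[OF from_vertex(1), of p q] that i(2) by (auto simp: z_def)
      next
        case 2
        have "z q = r (k + (q - i))" using 2 by (simp add: z_def)
        moreover have "x p \<noteq> r (k + (q - i))"
        proof (cases "p = i")
          case True
          then show ?thesis using k(1) injD[OF r(1), of k "k + (q - i)"] 2 by auto
        next
          case False
          then show ?thesis using first[of p] tailW 2 by (metis le_neq_implies_less)
        qed
        ultimately show ?thesis using 2 by (simp add: z_def)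
      next
        case 3
        then show ?thesis using injD[OF r(1), of "k + (p - i)" "k + (q - i)"] that by (auto simp: z_def)
      qed
    qed
    then have inj: "inj z" by (intro linorder_injI)
    have steps: "\<forall>j. (z j, z (Suc j)) \<in> arcs_ends D"
    proof
      fix j
      consider "j < i" | "j = i" | "j > i" by linarith
      then show "(z j, z (Suc j)) \<in> arcs_ends D"
      proof cases
        case 1
        then show ?thesis using from_vertex(5) i(2) by (simp add: z_def)
      next
        case 2
        then show ?thesis using r(4) k(1) by (simp add: z_def)
      next
        case 3
        then show ?thesis using r(4) by (simp add: z_def Suc_diff_le)
      qed
    qed
    obtain Z where Z: "subgraph Z D" "out_ray Z (z 0)" "verts Z = range z"
      using out_ray_through[OF wf inj steps] by blast
    have rng: "z j \<in> x ` {1..m} \<union> W" if "j \<noteq> 0" for j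
      using that i(2) tailW[of "j - i"] by (auto simp: z_def)
    have z0: "z 0 = x 0" by (simp add: z_def)
    have "z j \<in> verts T \<union> W" for j
      using rng[of j] z0 from_vertex(4) by (cases "j = 0") auto
    then have "verts Z \<subseteq> verts T \<union> W" unfolding Z(3) by blast
    then have avoid: "verts Z \<inter> S1 = {}" using T(4) WS1 by blast
    have "r (k + Suc n) \<in> verts R \<inter> verts Z" for n
    proof -
      have "r (k + Suc n) = z (i + Suc n)" by (simp add: z_def)
      then show ?thesis unfolding Z(3) r(3) by (metis IntI rangeI)
    qed
    then have "range (\<lambda>n. r (k + Suc n)) \<subseteq> verts R \<inter> verts Z" by blast
    then have "infinite (verts R \<inter> verts Z)" using inf_tail finite_subset by blast
    then have "Z \<in> b"
      using end_contains_ray[OF wf _ R(3), of Z] ends(2) R(4) Z(1,2) by (auto simp: rays_def)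
    moreover have "(verts Z - {z 0}) \<inter> vertex_part A = {}"
    proof (rule equals0I)
      fix u assume u: "u \<in> (verts Z - {z 0}) \<inter> vertex_part A"
      then obtain j where "u = z j" unfolding Z(3) by blast
      with u have "u \<in> x ` {1..m} \<union> W" using rng[of j] by auto
      with u show False using from_vertex(3) WA by blast
    qed
    moreover have "z 0 \<in> vertex_part A" using from_vertex(2) z0 by simp
    ultimately have "track D A {Inr b} Z" by (intro out_ray_trackI[OF Z(1,2)]) auto
    then show False using S1(2) avoid by blast
  next
    case (from_end x a I)
    have aD: "a \<in> ends D" and bD: "b \<in> ends D" using from_end(1) R(4) ends by auto
    obtain X where X: "subgraph X D" "in_ray X (x 0)" "verts X = range x"
      using in_ray_through[OF wf from_end(4,7)] by blast
    have "X \<in> a"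
      using end_contains_ray[OF wf aD from_end(2), of X] from_end(3) X by (auto simp: rays_def)
    \<comment> \<open>As \<open>x\<close> runs backwards, a first vertex in \<open>W\<close> is one of largest index; it exists
      iff only finitely many indices lead into \<open>W\<close>.\<close>
    show False
    proof (cases "finite {j. x j \<in> W}")
      case False
      then have "infinite (x ` {j. x j \<in> W})" using from_end(4) by (metis finite_imageD inj_on_subset subset_UNIV)
      moreover have "x ` {j. x j \<in> W} \<subseteq> verts X \<inter> verts R" unfolding X(3) r(3) W_def by auto
      ultimately have "infinite (verts X \<inter> verts R)" using finite_subset by blast
      then have "R \<in> a"
        using end_contains_ray[OF wf aD \<open>X \<in> a\<close>, of R] R(1,2) by (auto simp: rays_def)
      then have "a = b" using ends_eq[OF wf aD bD] R(3) by blast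
      then show False using S2(2)[of T] from_end(1,9) T(5) by blast
    next
      case True
      define i where "i = Max {j. x j \<in> W}"
      have "0 \<in> {j. x j \<in> W}" using from_end(5) T(3) by simp
      then have i: "x i \<in> W" using Max_in[OF True] unfolding i_def by blast
      have last: "x j \<notin> W" if "j > i" for j
        using Max_ge[OF True, of j] that unfolding i_def by auto
      obtain k where k: "x i = r k" "k \<ge> N" using i by (auto simp: W_def)
      have tailW: "r (k + j) \<in> W" for j using k(2) by (simp add: W_def)
      define z where "z j = (if j \<le> 0 then x (i + nat (- j)) else r (k + nat j))" for j :: int
      have "z p \<noteq> z q" if "p < q" for p q
      proof -
        consider "q \<le> 0" | "p \<le> 0" "0 < q" | "0 < p" using \<open>p < q\<close> by linarith
        then show ?thesis
        proof cases
          case 1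
          then show ?thesis using injD[OF from_end(4), of "i + nat (- p)" "i + nat (- q)"] that by (auto simp: z_def)
        next
          case 2
          have "x (i + nat (- p)) \<noteq> r (k + nat q)"
          proof (cases "p = 0")
            case True
            then show ?thesis using k(1) injD[OF r(1), of k "k + nat q"] 2 by auto
          next
            case False
            then show ?thesis using last[of "i + nat (- p)"] tailW 2 by auto
          qed
          then show ?thesis using 2 by (simp add: z_def)
        next
          case 3
          then show ?thesis using injD[OF r(1), of "k + nat p" "k + nat q"] that by (auto simp: z_def)
        qed
      qed
      then have inj: "inj z" by (intro linorder_injI)
      have steps: "\<forall>j. (z j, z (j + 1)) \<in> arcs_ends D"
      proof
        fix j :: int
        consider "j < 0" | "j = 0" | "j > 0" by linarith
        then show "(z j, z (j + 1)) \<in> arcs_ends D"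
        proof cases
          case 1
          then have "nat (- j) = Suc (nat (- (j + 1)))" by linarith
          then show ?thesis using from_end(7) 1 by (simp add: z_def)
        next
          case 2
          then show ?thesis using r(4) k(1) by (simp add: z_def)
        next
          case 3
          then have "nat (j + 1) = Suc (nat j)" by linarith
          then show ?thesis using r(4) 3 by (simp add: z_def)
        qed
      qed
      obtain Z I' J where Z: "subgraph Z D" "double_ray Z" "verts Z = range z"
        and I': "subgraph I' Z" "in_ray I' (z 0)" "verts I' = z ` {..0}"
        and J: "subgraph J Z" "out_ray J (z 0)" "verts J = z ` {0..}"
        using double_ray_through[OF wf inj steps] by blast
      have rng: "z j \<in> x ` {1..} \<union> W" for j
      proof (cases "j < 0")
        case False
        then show ?thesis using i tailW by (cases "j = 0") (auto simp: z_def)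
      qed (auto simp: z_def)
      have "verts Z \<subseteq> verts T \<union> W" using rng from_end(6) unfolding Z(3) by blast
      then have avoid: "verts Z \<inter> S1 = {}" using T(4) WS1 by blast
      have "verts I \<inter> range x \<subseteq> (verts I \<inter> verts I') \<union> x ` {..<i}"
      proof
        fix u assume u: "u \<in> verts I \<inter> range x"
        then obtain j where j: "u = x j" by blast
        show "u \<in> (verts I \<inter> verts I') \<union> x ` {..<i}"
        proof (cases "j < i")
          case False
          have "z (- int n) = x (i + n)" for n by (simp add: z_def)
          from this[of "j - i"] have "u = z (- int (j - i))" using False j by (simp only: le_add_diff_inverse not_less)
          then show ?thesis using u I'(3) by auto
        qed (use j in auto)
      qed
      then have "infinite (verts I \<inter> verts I')"
        using from_end(3) by (meson finite_UnI finite_imageI finite_lessThan finite_subset)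
      then have "I' \<in> a"
        using end_contains_ray[OF wf aD from_end(2), of I'] I'(2) subgraph_trans[OF I'(1) Z(1)]
        by (auto simp: rays_def)
      moreover have "J \<in> b"
      proof -
        have "r (k + Suc n) \<in> z ` {0..}" for n
          by (rule image_eqI[where x = "int (Suc n)"]) (simp_all add: z_def nat_add_distrib)
        then have "r (k + Suc n) \<in> verts R \<inter> verts J" for n
          unfolding J(3) r(3) by blast
        then have "range (\<lambda>n. r (k + Suc n)) \<subseteq> verts R \<inter> verts J" by blast
        then have "infinite (verts R \<inter> verts J)" using inf_tail finite_subset by blast
        then show ?thesis
          using end_contains_ray[OF wf bD R(3), of J] J(2) subgraph_trans[OF J(1) Z(1)]
          by (auto simp: rays_def)
      qed
      moreover have "verts Z \<inter> vertex_part A = {}"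
      proof (rule equals0I)
        fix u assume u: "u \<in> verts Z \<inter> vertex_part A"
        then have "u \<in> x ` {1..} \<union> W" using rng unfolding Z(3) by auto
        with u show False using from_end(8) WA by blast
      qed
      ultimately have "track D A {Inr b} Z"
        using from_end(1) by (intro double_ray_trackI[OF Z(1,2) I'(1,2) _ _ J(1,2)]) auto
      then show False using S1(2) avoid by blast
    qed
  qed
  have split: "verts R \<subseteq> r ` {..<N} \<union> W"
  proof
    fix u assume "u \<in> verts R"
    then obtain i where "u = r i" unfolding r(3) by blast
    then show "u \<in> r ` {..<N} \<union> W" unfolding W_def by (cases "i < N") auto
  qed
  have "verts T \<inter> (S1 \<union> S2 \<union> r ` {..<N}) \<noteq> {}" if T: "track D A B T" "verts T \<inter> verts R \<noteq> {}" for T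
  proof
    assume empty: "verts T \<inter> (S1 \<union> S2 \<union> r ` {..<N}) = {}"
    then obtain w where "w \<in> verts T" "w \<in> W" using T(2) split by blast
    moreover have "verts T \<inter> S1 = {}" "verts T \<inter> S2 = {}" using empty by blast+
    ultimately show False using no_hit[OF T(1)] by blast
  qed
  moreover have "finite (S1 \<union> S2 \<union> r ` {..<N})" using S1(1) S2(1) by simp
  ultimately show ?thesis by (intro guardedI)
qed

section \<open>Reversing all arcs\<close>

text \<open>
  Reversal exchanges in-rays and out-rays, and turns \<open>A\<close>--\<open>B\<close> tracks into
  \<open>B\<close>--\<open>A\<close> tracks. Since rays carry their own arcs, ends have to be reversed ray by
  ray.
\<close>

definition rev_digraph :: "('a,'b) pre_digraph \<Rightarrow> ('a,'b) pre_digraph" where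
  "rev_digraph G = G\<lparr>tail := head G, head := tail G\<rparr>"

abbreviation rev_parts :: "('a,'b) verts_ends \<Rightarrow> ('a,'b) verts_ends" where
  "rev_parts A \<equiv> map_sum id (image rev_digraph) ` A"

lemma rev_digraph_simps [simp]:
  "verts (rev_digraph G) = verts G" "arcs (rev_digraph G) = arcs G"
  "tail (rev_digraph G) = head G" "head (rev_digraph G) = tail G"
  "rev_digraph (rev_digraph G) = G"
  by (simp_all add: rev_digraph_def)

lemma inj_rev_digraph: "inj rev_digraph"
  by (rule inj_on_inverseI[where g = rev_digraph]) simp

lemma wf_digraph_rev [simp]: "wf_digraph (rev_digraph G) \<longleftrightarrow> wf_digraph G"
  by (auto simp: wf_digraph_def)

lemma subgraph_rev [simp]: "subgraph (rev_digraph H) (rev_digraph G) \<longleftrightarrow> subgraph H G"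
  by (auto simp: subgraph_def compatible_def)

lemma ray_rev [simp]:
  "in_ray (rev_digraph R) v \<longleftrightarrow> out_ray R v" "out_ray (rev_digraph R) v \<longleftrightarrow> in_ray R v"
  by (simp_all add: in_ray_def out_ray_def conj_commute)

lemma double_ray_rev:
  assumes "double_ray R"
  shows "double_ray (rev_digraph R)"
proof -
  obtain x :: "int \<Rightarrow> 'a" and e where x: "inj x" "verts R = range x" "arcs R = range e"
    "\<And>i. tail R (e i) = x i \<and> head R (e i) = x (i + 1)"
    using assms unfolding double_ray_def by blast
  let ?x = "\<lambda>i. x (- i)" and ?e = "\<lambda>i. e (- (i + 1))"
  have surj: "range (\<lambda>i::int. - i) = UNIV" "range (\<lambda>i::int. - (i + 1)) = UNIV"
    by (rule surjI[where f = uminus], simp) (rule surjI[where f = "\<lambda>i. - i - 1"], simp)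
  have "inj ?x" using injD[OF x(1)] by (force intro: injI)
  moreover have "range ?x = range x" "range ?e = range e"
    using surj by (metis image_image)+
  moreover have "head R (?e i) = ?x i \<and> tail R (?e i) = ?x (i + 1)" for i
    using x(4)[of "- (i + 1)"] by simp
  ultimately show ?thesis
    unfolding double_ray_def using x(2,3) by (intro exI[of _ ?x] exI[of _ ?e]) simp
qed

lemma is_path_rev:
  assumes "is_path P u v"
  shows "is_path (rev_digraph P) v u"
proof -
  obtain n x e where x: "inj_on x {..n::nat}" "x 0 = u" "x n = v" "verts P = x ` {..n}"
      "arcs P = e ` {..<n}" "\<forall>i<n. tail P (e i) = x i \<and> head P (e i) = x (Suc i)"
    using assms unfolding is_path_iff by blast
  let ?x = "\<lambda>i. x (n - i)" and ?e = "\<lambda>i. e (n - Suc i)"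
  have refl: "(\<lambda>i. n - i) ` {..n} = {..n}" "(\<lambda>i. n - Suc i) ` {..<n} = {..<n}"
  proof -
    have "i \<in> (\<lambda>i. n - i) ` {..n}" if "i \<le> n" for i
      using that by (intro image_eqI[of _ _ "n - i"]) auto
    then show "(\<lambda>i. n - i) ` {..n} = {..n}" by auto
    have "i \<in> (\<lambda>i. n - Suc i) ` {..<n}" if "i < n" for i
      using that by (intro image_eqI[of _ _ "n - Suc i"]) auto
    then show "(\<lambda>i. n - Suc i) ` {..<n} = {..<n}" by auto
  qed
  have "inj_on ?x {..n}"
  proof (rule inj_onI)
    fix i j assume "i \<in> {..n}" "j \<in> {..n}" "x (n - i) = x (n - j)"
    then show "i = j" using inj_onD[OF x(1), of "n - i" "n - j"] by auto
  qed
  moreover have "?x ` {..n} = x ` {..n}" "?e ` {..<n} = e ` {..<n}"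
    using refl by (metis image_image)+
  moreover have "head P (?e i) = ?x i \<and> tail P (?e i) = ?x (Suc i)" if "i < n" for i
    using x(6)[rule_format, of "n - Suc i"] that Suc_diff_Suc[OF that] by simp
  ultimately show ?thesis
    unfolding is_path_iff using x(2-5) by (intro exI[of _ n] exI[of _ ?x] exI[of _ ?e]) simp
qed

lemma set_path_rev:
  assumes "set_path D X Y P"
  shows "set_path (rev_digraph D) Y X (rev_digraph P)"
proof -
  obtain u v where "subgraph P D" "is_path P u v" "verts P \<inter> X = {u}" "verts P \<inter> Y = {v}"
    using assms unfolding set_path_def by blast
  then show ?thesis unfolding set_path_def using is_path_rev[of P u v] by auto
qed

lemma rays_rev [simp]: "rev_digraph R \<in> rays (rev_digraph D) \<longleftrightarrow> R \<in> rays D"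
  by (auto simp: rays_def)

lemma inf_many_paths_rev:
  assumes "inf_many_paths D R\<^sub>1 R\<^sub>2"
  shows "inf_many_paths (rev_digraph D) (rev_digraph R\<^sub>2) (rev_digraph R\<^sub>1)"
proof -
  obtain \<P> where P: "infinite \<P>" "disjoint_digraphs \<P>" "\<forall>P\<in>\<P>. set_path D (verts R\<^sub>1) (verts R\<^sub>2) P"
    using assms unfolding inf_many_paths_def by blast
  have "infinite (rev_digraph ` \<P>)"
    using P(1) finite_imageD[of rev_digraph \<P>] inj_rev_digraph by (meson inj_on_subset subset_UNIV)
  moreover have "disjoint_digraphs (rev_digraph ` \<P>)"
    using P(2) by (auto simp: pairwise_def)
  ultimately show ?thesis
    unfolding inf_many_paths_def using P(3) set_path_rev[of D "verts R\<^sub>1" "verts R\<^sub>2"]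
    by (intro exI[of _ "rev_digraph ` \<P>"]) auto
qed

lemma ray_equiv_rev:
  "(rev_digraph R\<^sub>1, rev_digraph R\<^sub>2) \<in> ray_equiv (rev_digraph D) \<longleftrightarrow> (R\<^sub>1, R\<^sub>2) \<in> ray_equiv D"
proof -
  have "(rev_digraph R, rev_digraph S) \<in> ray_equiv (rev_digraph G)" if "(R, S) \<in> ray_equiv G"
    for R S and G :: "('a,'b) pre_digraph"
    using that inf_many_paths_rev[of G] by (auto simp: ray_equiv_def)
  from this[of R\<^sub>1 R\<^sub>2 D] this[of "rev_digraph R\<^sub>1" "rev_digraph R\<^sub>2" "rev_digraph D"]
  show ?thesis by auto
qed

lemma ends_rev:
  assumes "a \<in> ends D"
  shows "rev_digraph ` a \<in> ends (rev_digraph D)"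
proof -
  obtain R where R: "R \<in> rays D" "a = ray_equiv D `` {R}"
    using assms unfolding ends_def by (rule quotientE)
  have "rev_digraph ` a = ray_equiv (rev_digraph D) `` {rev_digraph R}"
  proof (intro set_eqI iffI)
    fix S assume "S \<in> ray_equiv (rev_digraph D) `` {rev_digraph R}"
    then have "(R, rev_digraph S) \<in> ray_equiv D"
      using ray_equiv_rev[of R "rev_digraph S" D] by simp
    then show "S \<in> rev_digraph ` a" using R(2) by (intro image_eqI[of _ _ "rev_digraph S"]) auto
  qed (auto simp: R(2) ray_equiv_rev)
  then show ?thesis unfolding ends_def using R(1) by (auto intro: quotientI)
qed

lemma Inl_rev_parts [simp]: "Inl v \<in> rev_parts A \<longleftrightarrow> Inl v \<in> A"
proof
  assume "Inl v \<in> rev_parts A"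
  then obtain z where "z \<in> A" "Inl v = map_sum id (image rev_digraph) z" by blast
  then show "Inl v \<in> A" by (cases z) auto
qed (rule image_eqI[of _ _ "Inl v"], auto)

lemma Inr_rev_parts [simp]: "Inr b \<in> rev_parts A \<longleftrightarrow> b \<in> image rev_digraph ` end_part A"
proof
  assume "Inr b \<in> rev_parts A"
  then obtain z where "z \<in> A" "Inr b = map_sum id (image rev_digraph) z" by blast
  then show "b \<in> image rev_digraph ` end_part A" by (cases z) auto
next
  assume "b \<in> image rev_digraph ` end_part A"
  then obtain a where "Inr a \<in> A" "b = rev_digraph ` a" by blast
  then show "Inr b \<in> rev_parts A" by (intro image_eqI[of _ _ "Inr a"]) auto
qed

lemma rev_parts_simps [simp]:
  "vertex_part (rev_parts A) = vertex_part A"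
  "end_part (rev_parts A) = image rev_digraph ` end_part A"
  "rev_parts (rev_parts A) = A"
proof -
  show "vertex_part (rev_parts A) = vertex_part A"
    by (rule set_eqI) (simp only: vimage_eq Inl_rev_parts)
  show "end_part (rev_parts A) = image rev_digraph ` end_part A"
    by (rule set_eqI) (simp only: vimage_eq Inr_rev_parts)
  have "map_sum id (image rev_digraph) (map_sum id (image rev_digraph) z) = z"
    for z :: "'a + ('a,'b) pre_digraph set"
    by (cases z) (auto simp: image_image)
  then show "rev_parts (rev_parts A) = A" by (simp add: image_image)
qed

lemma track_rev:
  assumes "track D A B T"
  shows "track (rev_digraph D) (rev_parts B) (rev_parts A) (rev_digraph T)"
proof -
  have sub: "subgraph (rev_digraph T) (rev_digraph D)" using assms by (simp add: track_def)
  show ?thesis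
    using assms
  proof (cases rule: track_cases)
    case path
    have "set_path (rev_digraph D) (vertex_part (rev_parts B)) (vertex_part (rev_parts A)) (rev_digraph T)"
      using set_path_rev[OF path] by simp
    then show ?thesis unfolding track_def by (rule conjI[OF sub disjI1])
  next
    case (in_ray v a)
    then show ?thesis
      by (intro out_ray_trackI[OF sub, of v _ "rev_digraph ` a"]) auto
  next
    case (out_ray v b)
    then show ?thesis
      by (intro in_ray_trackI[OF sub, of v "rev_digraph ` b"]) auto
  next
    case (double_ray I v a J w b)
    then show ?thesis
      by (intro double_ray_trackI[OF sub double_ray_rev, of "rev_digraph J" w "rev_digraph ` b" _
            "rev_digraph I" v "rev_digraph ` a"]) auto
  qed
qed

lemma dispersed_rev:
  assumes "dispersed D A B"
  shows "dispersed (rev_digraph D) (rev_parts B) (rev_parts A)"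
  unfolding dispersed_def
proof (intro conjI ballI)
  fix b' assume "b' \<in> end_part (rev_parts B)"
  then obtain b where b: "b' = rev_digraph ` b" "b \<in> end_part B" by auto
  obtain S where S: "finite S" "S \<subseteq> verts D" "\<not> (\<exists>T. track_avoiding D S A {Inr b} T)"
    using bspec[OF conjunct2[OF assms[unfolded dispersed_def]] b(2)] by blast
  have "\<not> track_avoiding (rev_digraph D) S {Inr b'} (rev_parts A) T" for T
  proof
    assume "track_avoiding (rev_digraph D) S {Inr b'} (rev_parts A) T"
    then have "track D A (rev_parts {Inr b'}) (rev_digraph T)" "verts T \<inter> S = {}"
      using track_rev[of "rev_digraph D" "{Inr b'}" "rev_parts A" T] by (auto simp: track_avoiding_def)
    then have "track_avoiding D S A {Inr b} (rev_digraph T)"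
      by (simp add: track_avoiding_def b(1) image_image)
    then show False using S(3) by blast
  qed
  then show "\<exists>S. finite S \<and> S \<subseteq> verts (rev_digraph D) \<and>
      \<not> (\<exists>T. track_avoiding (rev_digraph D) S {Inr b'} (rev_parts A) T)"
    using S(1,2) by auto
next
  fix a' assume "a' \<in> end_part (rev_parts A)"
  then obtain a where a: "a' = rev_digraph ` a" "a \<in> end_part A" by auto
  obtain S where S: "finite S" "S \<subseteq> verts D" "\<not> (\<exists>T. track_avoiding D S {Inr a} B T)"
    using bspec[OF conjunct1[OF assms[unfolded dispersed_def]] a(2)] by blast
  have "\<not> track_avoiding (rev_digraph D) S (rev_parts B) {Inr a'} T" for T
  proof
    assume "track_avoiding (rev_digraph D) S (rev_parts B) {Inr a'} T"
    then have "track D (rev_parts {Inr a'}) B (rev_digraph T)" "verts T \<inter> S = {}"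
      using track_rev[of "rev_digraph D" "rev_parts B" "{Inr a'}" T] by (auto simp: track_avoiding_def)
    then have "track_avoiding D S {Inr a} B (rev_digraph T)"
      by (simp add: track_avoiding_def a(1) image_image)
    then show False using S(3) by blast
  qed
  then show "\<exists>S. finite S \<and> S \<subseteq> verts (rev_digraph D) \<and>
      \<not> (\<exists>T. track_avoiding (rev_digraph D) S (rev_parts B) {Inr a'} T)"
    using S(1,2) by auto
qed

lemma guarded_in_ray:
  assumes wf: "wf_digraph D" and ends: "end_part A \<subseteq> ends D" "end_part B \<subseteq> ends D"
    and disp: "dispersed D A B"
    and R: "subgraph R D" "in_ray R v" "R \<in> a" "a \<in> end_part A" "(verts R - {v}) \<inter> vertex_part B = {}"
  shows "guarded D A B (verts R)"
proof -
  have "guarded (rev_digraph D) (rev_parts B) (rev_parts A) (verts (rev_digraph R))"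
  proof (rule guarded_out_ray)
    show "dispersed (rev_digraph D) (rev_parts B) (rev_parts A)" using dispersed_rev[OF disp] .
    show "end_part (rev_parts B) \<subseteq> ends (rev_digraph D)" "end_part (rev_parts A) \<subseteq> ends (rev_digraph D)"
      using ends ends_rev by (auto simp: subset_iff)
    show "rev_digraph R \<in> rev_digraph ` a" "rev_digraph ` a \<in> end_part (rev_parts A)"
      using R(3,4) by auto
  qed (use wf R in auto)
  then obtain S where S: "finite S"
    "\<And>T. track (rev_digraph D) (rev_parts B) (rev_parts A) T \<Longrightarrow> verts T \<inter> verts R \<noteq> {} \<Longrightarrow> verts T \<inter> S \<noteq> {}"
    unfolding guarded_def by auto
  show ?thesis
  proof (rule guardedI[OF S(1)])
    fix T assume "track D A B T" "verts T \<inter> verts R \<noteq> {}"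
    then show "verts T \<inter> S \<noteq> {}" using S(2)[OF track_rev] by simp
  qed
qed

section \<open>Extending families of disjoint tracks\<close>

text \<open>
  An in-ray or out-ray track is guarded as a whole. In a double ray, the in-ray and the out-ray
  that lie in its two ends are guarded, and they cover all but finitely many of its vertices.
\<close>

lemma guarded_track:
  assumes wf: "wf_digraph D" and ends: "end_part A \<subseteq> ends D" "end_part B \<subseteq> ends D"
    and disp: "dispersed D A B" and T: "track D A B T"
  shows "guarded D A B (verts T)"
proof -
  have sub: "subgraph T D" using T by (simp add: track_def)
  show ?thesis
    using T
  proof (cases rule: track_cases)
    case path
    then have "finite (verts T)" unfolding set_path_def is_path_def by auto
    then show ?thesis by (rule guarded_finite)
  next
    case (in_ray v a)
    show ?thesis by (rule guarded_in_ray[OF wf ends disp sub in_ray(1,3,2)]) (use in_ray(5) in blast)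
  next
    case (out_ray v b)
    show ?thesis by (rule guarded_out_ray[OF wf ends disp sub out_ray(1,4,3)]) (use out_ray(5) in blast)
  next
    case (double_ray I v a J w b)
    obtain y :: "int \<Rightarrow> 'a" where y: "inj y" "verts T = range y"
      "arcs_ends T \<subseteq> range (\<lambda>i. (y i, y (i + 1)))"
      by (rule double_ray_in_verts[OF sub double_ray(1)])
    obtain c where c: "verts I = y ` {..c}"
      using in_ray_in_double_ray[OF y(1,3) double_ray(2,3)] by blast
    obtain d where d: "verts J = y ` {d..}"
      using out_ray_in_double_ray[OF y(1,3) double_ray(6,7)] by blast
    have IT: "verts I \<subseteq> verts T" "verts J \<subseteq> verts T" using c d y(2) by auto
    have "guarded D A B (verts I)"
      by (rule guarded_in_ray[OF wf ends disp subgraph_trans[OF double_ray(2) sub] double_ray(3,5,4)])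
        (use double_ray(10) IT(1) in blast)
    moreover have "guarded D A B (verts J)"
      by (rule guarded_out_ray[OF wf ends disp subgraph_trans[OF double_ray(6) sub] double_ray(7,9,8)])
        (use double_ray(10) IT(2) in blast)
    moreover have "guarded D A B (y ` {c..d})" by (rule guarded_finite) simp
    ultimately have "guarded D A B (verts I \<union> verts J \<union> y ` {c..d})" by (intro guarded_Un)
    moreover have "verts T \<subseteq> verts I \<union> verts J \<union> y ` {c..d}"
    proof
      fix u assume "u \<in> verts T"
      then obtain i where "u = y i" unfolding y(2) by blast
      then show "u \<in> verts I \<union> verts J \<union> y ` {c..d}"
        unfolding c d by (cases "i \<le> c"; cases "d \<le> i") auto
    qed
    ultimately show ?thesis by (rule guarded_subset)
  qed
qed

lemma track_nonempty:
  assumes "track D A B T"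
  shows "verts T \<noteq> {}"
  using assms
  by (cases rule: track_cases) (auto simp: set_path_def in_ray_def out_ray_def double_ray_def)

theorem lemma6p3:
  fixes D :: "('a,'b) pre_digraph"
    and A B :: "('a,'b) verts_ends"
  assumes "wf_digraph D"
    and "A \<subseteq> verts D <+> ends D" and "B \<subseteq> verts D <+> ends D"
    and "dispersed D A B"
    and "\<forall>n::nat. n \<ge> 1 \<longrightarrow>
           (\<exists>\<T>. finite \<T> \<and> card \<T> = n \<and> disjoint_digraphs \<T> \<and> (\<forall>T\<in>\<T>. track D A B T))"
  shows "\<exists>\<T>. infinite \<T> \<and> disjoint_digraphs \<T> \<and> (\<forall>T\<in>\<T>. track D A B T)"
proof (rule infinite_disjoint_family)
  fix \<F> assume F: "finite \<F>" "\<forall>F\<in>\<F>. track D A B F"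
  have ends: "end_part A \<subseteq> ends D" "end_part B \<subseteq> ends D" using assms(2,3) by auto
  have "guarded D A B (\<Union>F\<in>\<F>. verts F)"
    using F
  proof (induction rule: finite_induct)
    case empty
    show ?case by (simp add: guarded_finite)
  next
    case (insert F \<F>)
    have "guarded D A B (verts F)" using guarded_track[OF assms(1) ends assms(4)] insert(4) by blast
    moreover have "guarded D A B (\<Union>F\<in>\<F>. verts F)" using insert(3,4) by blast
    ultimately have "guarded D A B (verts F \<union> (\<Union>F\<in>\<F>. verts F))" by (rule guarded_Un)
    then show ?case by simp
  qed
  then obtain S where S: "finite S"
    "\<And>T. track D A B T \<Longrightarrow> verts T \<inter> (\<Union>F\<in>\<F>. verts F) \<noteq> {} \<Longrightarrow> verts T \<inter> S \<noteq> {}"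
    unfolding guarded_def by auto
  \<comment> \<open>One track more than \<open>S\<close> can meet.\<close>
  obtain \<T> where \<T>: "card \<T> = Suc (card S)" "disjoint_digraphs \<T>" "\<forall>T\<in>\<T>. track D A B T"
    using assms(5)[rule_format, of "Suc (card S)"] by auto
  obtain T where T: "T \<in> \<T>" "verts T \<inter> S = {}"
    using disjoint_member_avoiding[OF \<T>(2) S(1)] \<T>(1) by auto
  then have "verts T \<inter> (\<Union>F\<in>\<F>. verts F) = {}" using S(2)[of T] \<T>(3) by auto
  then show "\<exists>T. track D A B T \<and> (\<forall>F\<in>\<F>. verts T \<inter> verts F = {})"
    using T(1) \<T>(3) by blast
qed (rule track_nonempty)

end
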